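(* Let $\mathbb{F}$ be an algebraically closed field of characteristic zero, let $\mathcal{C}\subset\mathbb{F}^2$ be an irreducible affine plane curve parametrizable by radicals, let $A\in\mathbb{F}^2$, and let $d\in\mathbb{F}\setminus\{0\}$. Then the conchoid to $\mathcal{C}$ from $A$ at distance $d$ is also parametrizable by radicals.
   Context: Write $\|(x,y)\|_2^2=x^2+y^2$ ($\|(x,y)\|_2$ being a square root of $x^2+y^2$ in $\mathbb{F}$). The conchoid to $\mathcal{C}$ at distance $d$ from the focus $A$ is the Zariski closure in $\mathbb{F}^2$ of $$\Big\{P\pm\frac{d}{\|A-P\|_2}(A-P)\ :\ P\in\mathcal{C},\ \|A-P\|_2\neq0\Big\}.$$ Let $t$ be transcendental over $\mathbb{F}$, $\mathbb{K}=\mathbb{F}(t)$, and fix an algebraic closure $\overline{\mathbb{K}}$ of $\mathbb{K}$. Root towers. For $g\in\mathbb{K}[x]$, a root tower for $g$ over $\mathbb{K}$ is a finite tower of fields $\mathbb{K}=\mathbb{K}_0\subset\mathbb{K}_1\subset\cdots\subset\mathbb{K}_s=\mathbb{E}$ (inside $\overline{\mathbb{K}}$) such that each $\mathbb{K}_i$ is the splitting field over $\mathbb{K}_{i-1}$ of a polynomial $x^{\ell_i}-a_i\in\mathbb{K}_{i-1}[x]$ with $\ell_i>0$, $a_i\neq0$, and the splitting field of $g$ over $\mathbb{K}$ is contained in $\mathbb{K}_s$; $g$ is soluble (by radicals) over $\mathbb{K}$ if such a tower exists. Affine square parametrization: a tuple $(R_1,\ldots,R_n)\in\mathbb{E}^n\setminus\mathbb{F}^n$,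 where $\mathbb{E}$ is the last field of a root tower over $\mathbb{K}$ of some $g\in\mathbb{K}[x]$ soluble over $\mathbb{K}$. Evaluation. For each $t_0\in\mathbb{F}$ fix a place of $\overline{\mathbb{K}}$ over $\mathbb{F}$ extending $t\mapsto t_0$, i.e. a valuation ring $O_{t_0}\supset\mathbb{F}$ of $\overline{\mathbb{K}}$ with $t-t_0$ in its maximal ideal; its residue field is $\mathbb{F}$ (this is a compatible choice of the values at $t_0$ of all radicals). $S(t_0)$ is well defined if $S\in O_{t_0}$, and then it is the residue of $S$ in $\mathbb{F}$; tuples are evaluated coordinatewise. Parametrizable by radicals. A set $\mathcal{E}\subset\mathbb{F}^n$ (an irreducible affine curve, or the conchoid, which may be reducible) is parametrizable by radicals if there is a finite set of square parametrizations $\{\mathcal{P}_i(t)\}_i$ such that (1) for all $i$ and all $t_0\in\mathbb{F}$ such that $\mathcal{P}_i(t_0)$ is defined, $\mathcal{P}_i(t_0)\in\mathcal{E}$; (2) for all but finitely many $P\in\mathcal{E}$ there exist $t_0\in\mathbb{F}$ and $i$ with $P=\mathcal{P}_i(t_0)$. *)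

theory Defs
  imports
    "HOL-Algebra.Algebraic_Closure_Type"
    "HOL-Computational_Algebra.Computational_Algebra"
    "HOL-Analysis.Finite_Cartesian_Product"
    "HOL.Hull"
begin

section \<open>Affine plane geometry over a field\<close>

text \<open>
  An element \<open>f\<close> of \<open>F[x][y]\<close> stands for a polynomial in \<open>F[x, y]\<close>: the coefficients are
  polynomials in \<open>x\<close>, the outer variable is \<open>y\<close>.
\<close>

definition eval2 :: "'a::field poly poly \<Rightarrow> 'a ^ 2 \<Rightarrow> 'a" where
  "eval2 f P = poly (poly f [:P $ 2:]) (P $ 1)"

definition zariski_closed :: "('a::field ^ 2) set \<Rightarrow> bool" where
  "zariski_closed Z \<longleftrightarrow> (\<exists>I. Z = {P. \<forall>f\<in>I. eval2 f P = 0})"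

definition zariski_closure :: "('a::field ^ 2) set \<Rightarrow> ('a ^ 2) set" where
  "zariski_closure S = zariski_closed hull S"

definition irreducible_plane_curve :: "('a::alg_closed_field ^ 2) set \<Rightarrow> bool" where
  "irreducible_plane_curve C \<longleftrightarrow>
     (\<exists>f. Factorial_Ring.irreducible f \<and> C = {P. eval2 f P = 0})"

definition norm2_sq :: "'a::field ^ 2 \<Rightarrow> 'a" where
  "norm2_sq v = (v $ 1)\<^sup>2 + (v $ 2)\<^sup>2"

text \<open>
  Below \<open>s\<close> ranges over the square roots of \<open>norm2_sq (A - P)\<close>; because of the sign, the two
  points obtained from \<open>P\<close> do not depend on which root is taken.
\<close>

definition conchoid :: "('a::alg_closed_field ^ 2) set \<Rightarrow> 'a ^ 2 \<Rightarrow> 'a \<Rightarrow> ('a ^ 2) set" where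
  "conchoid C A d = zariski_closure
     {Q. \<exists>P\<in>C. \<exists>s. s\<^sup>2 = norm2_sq (A - P) \<and> s \<noteq> 0 \<and>
           (Q = P + (d / s) *s (A - P) \<or> Q = P - (d / s) *s (A - P))}"


section \<open>The function field and its algebraic closure\<close>

type_synonym 'a fun_field = "'a poly fract"
type_synonym 'a fun_field_ac = "'a poly fract alg_closure"

definition const_ac :: "'a::field \<Rightarrow> 'a fun_field_ac" where
  "const_ac c = to_ac (to_fract [:c:])"

definition t_ac :: "'a::field fun_field_ac" where
  "t_ac = to_ac (to_fract [:0, 1:])"

definition base_field :: "'a::field fun_field_ac set" where
  "base_field = range to_ac"


section \<open>Root towers and square parametrizations\<close>

definition is_subfield :: "'k::field set \<Rightarrow> bool" where
  "is_subfield L \<longleftrightarrow> 1 \<in> L \<and>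
     (\<forall>x\<in>L. \<forall>y\<in>L. x - y \<in> L \<and> x * y \<in> L) \<and> (\<forall>x\<in>L. inverse x \<in> L)"

text \<open>
  The splitting field over \<open>L\<close>, inside a fixed algebraically closed field, of a nonzero polynomial
  with coefficients in \<open>L\<close>.
\<close>

definition splitting_field :: "'k::alg_closed_field set \<Rightarrow> 'k poly \<Rightarrow> 'k set" where
  "splitting_field L p = is_subfield hull (L \<union> {x. poly p x = 0})"

definition root_tower ::
    "'a::field fun_field poly \<Rightarrow> 'a fun_field_ac set list \<Rightarrow> bool" where
  "root_tower g Ks \<longleftrightarrow>
     g \<noteq> 0 \<and> Ks \<noteq> [] \<and> hd Ks = base_field \<and>
     (\<forall>i. Suc i < length Ks \<longrightarrow>
        (\<exists>l a. l > 0 \<and> a \<in> Ks ! i \<and> a \<noteq> 0 \<and>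
           Ks ! Suc i = splitting_field (Ks ! i) (Polynomial.monom 1 l - [:a:]))) \<and>
     splitting_field base_field (map_poly to_ac g) \<subseteq> last Ks"

definition soluble_by_radicals :: "'a::field fun_field poly \<Rightarrow> bool" where
  "soluble_by_radicals g \<longleftrightarrow> (\<exists>Ks. root_tower g Ks)"

definition square_parametrization :: "'a::field fun_field_ac ^ 'n \<Rightarrow> bool" where
  "square_parametrization R \<longleftrightarrow>
     (\<exists>g Ks. soluble_by_radicals g \<and> root_tower g Ks \<and> (\<forall>i. R $ i \<in> last Ks)) \<and>
     \<not> (\<forall>i. R $ i \<in> range const_ac)"


section \<open>Places and evaluation\<close>

definition valuation_subring :: "'k::field set \<Rightarrow> bool" where
  "valuation_subring V \<longleftrightarrow> 1 \<in> V \<and>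
     (\<forall>x\<in>V. \<forall>y\<in>V. x - y \<in> V \<and> x * y \<in> V) \<and> (\<forall>x. x \<in> V \<or> inverse x \<in> V)"

definition valuation_ideal :: "'k::field set \<Rightarrow> 'k set" where
  "valuation_ideal V = {x \<in> V. x = 0 \<or> inverse x \<notin> V}"

definition place_at :: "'a::field \<Rightarrow> 'a fun_field_ac set \<Rightarrow> bool" where
  "place_at t0 V \<longleftrightarrow>
     valuation_subring V \<and> range const_ac \<subseteq> V \<and> t_ac - const_ac t0 \<in> valuation_ideal V"

text \<open>
  If \<open>F\<close> is algebraically closed and \<open>place_at t0 V\<close> holds, then the residue field of \<open>V\<close> is \<open>F\<close>,
  so every \<open>S \<in> V\<close> has exactly one residue in \<open>F\<close>. For \<open>S \<notin> V\<close> the value is junk.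
\<close>

definition place_value :: "'a::field fun_field_ac set \<Rightarrow> 'a fun_field_ac \<Rightarrow> 'a" where
  "place_value V S = (THE c. S - const_ac c \<in> valuation_ideal V)"

definition defined_at :: "'a::field fun_field_ac set \<Rightarrow> 'a fun_field_ac ^ 'n \<Rightarrow> bool" where
  "defined_at V R \<longleftrightarrow> (\<forall>i. R $ i \<in> V)"

definition eval_at :: "'a::field fun_field_ac set \<Rightarrow> 'a fun_field_ac ^ 'n \<Rightarrow> 'a ^ 'n" where
  "eval_at V R = (\<chi> i. place_value V (R $ i))"

text \<open>
  \<open>V\<close> is the family of places used for evaluation, one for each parameter value \<open>t0\<close>.
  The empty family of parametrizations is allowed: the conchoid may be empty.
\<close>

definition parametrizable_by_radicals ::
    "('a::field \<Rightarrow> 'a fun_field_ac set) \<Rightarrow> ('a ^ 'n) set \<Rightarrow> bool" where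
  "parametrizable_by_radicals V E \<longleftrightarrow>
     (\<exists>Rs. finite Rs \<and> (\<forall>R\<in>Rs. square_parametrization R) \<and>
        (\<forall>R\<in>Rs. \<forall>t0. defined_at (V t0) R \<longrightarrow> eval_at (V t0) R \<in> E) \<and>
        finite {P \<in> E. \<not> (\<exists>t0. \<exists>R\<in>Rs. defined_at (V t0) R \<and> P = eval_at (V t0) R)})"

end

theory Submission
  imports Defs "HOL-Analysis.Cartesian_Space"
begin

(* The dollar sign denotes components of vectors throughout. *)
no_notation fps_nth (infixl \<open>$\<close> 75)

text \<open>
  The conchoid is obtained from the curve by field operations and one square root, the distance to
  \<open>A\<close>; so a parametrization \<open>R\<close> of the curve by radicals yields the parametrizations
  \<open>R + (d / S) (A - R)\<close>, where \<open>S\<close> runs over the nonzero square roots of \<open>norm2_sq (A - R)\<close>, and a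
  root tower for \<open>R\<close> extends by one step to a tower that contains \<open>S\<close>
  (\<open>square_parametrization_conchoid_point\<close>). Constant tuples among them are discarded.

  That these tuples only take values in the conchoid follows from the fact that an element of the
  algebraic closure of \<open>F(t)\<close> is defined at almost all parameters, and is zero if it takes the value
  0 at almost all of them. An equation satisfied by all swept points is therefore an identity for
  the new tuple, and holds at every parameter (\<open>eval_at_conchoid_point_in_conchoid\<close>).

  Every swept point \<open>P + (d / s) (A - P)\<close> for which \<open>P\<close> is a value of \<open>R\<close> is a value of one of the new
  tuples, because \<open>S\<close> or \<open>- S\<close> takes the value \<open>s\<close> (\<open>conchoid_point_is_value\<close>). So only finitely many
  swept points are missed: those coming from the finitely many missed points \<open>P\<close>, and those given by
  the discarded constant tuples.

  The geometric part is that the Zariski closure adds only finitely many points to the swept ones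
  (\<open>finite_conchoid_minus_points\<close>). The construction is invertible: \<open>P\<close> is recovered from \<open>Q\<close> with a
  square root of the squared distance from \<open>Q\<close> to \<open>A\<close>. Substituting this into the equation of the
  curve and taking the norm that eliminates the root gives a nonzero polynomial \<open>H\<close>, whose zeros are
  the swept points as long as \<open>Q\<close> stays away from the isotropic lines through \<open>A\<close> and the circle of
  radius \<open>d\<close> around \<open>A\<close>. On this exceptional curve the swept points are closed up to the point \<open>A\<close>,
  and by a weak form of Bezout's theorem the components of \<open>H\<close> that are not contained in it meet it in
  finitely many points.
\<close>


section \<open>Polynomials in two variables\<close>

lemma eval2_0 [simp]: "eval2 0 P = 0"
  by (simp add: eval2_def)

lemma eval2_1 [simp]: "eval2 1 P = 1"
  by (simp add: eval2_def)

lemma eval2_pCons: "eval2 (pCons a f) P = poly a (P $ 1) + P $ 2 * eval2 f P"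
  by (simp add: eval2_def)

lemma eval2_add [simp]: "eval2 (f + g) P = eval2 f P + eval2 g P"
  by (simp add: eval2_def)

lemma eval2_diff [simp]: "eval2 (f - g) P = eval2 f P - eval2 g P"
  by (simp add: eval2_def)

lemma eval2_mult [simp]: "eval2 (f * g) P = eval2 f P * eval2 g P"
  by (simp add: eval2_def)

lemma eval2_const [simp]: "eval2 [:c:] P = poly c (P $ 1)"
  by (simp add: eval2_pCons)

text \<open>
  A class of functions that contains the constants and is closed under sums and products also
  contains every polynomial expression in two of its members. The class \<open>T\<close> varies below:
  polynomial functions on the plane, on a line, and functions involving one square root.
\<close>

lemma eval2_comp_closed:
  fixes u :: "'i \<Rightarrow> 'b::field ^ 2"
  assumes const: "\<And>c. T (\<lambda>_. c)"
    and add: "\<And>\<phi> \<psi>. T \<phi> \<Longrightarrow> T \<psi> \<Longrightarrow> T (\<lambda>i. \<phi> i + \<psi> i)"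
    and mult: "\<And>\<phi> \<psi>. T \<phi> \<Longrightarrow> T \<psi> \<Longrightarrow> T (\<lambda>i. \<phi> i * \<psi> i)"
    and coord: "T (\<lambda>i. u i $ 1)" "T (\<lambda>i. u i $ 2)"
  shows "T (\<lambda>i. eval2 f (u i))"
proof (induction f)
  case 0
  show ?case using const[of 0] by simp
next
  case (pCons a f)
  have "T (\<lambda>i. poly a (u i $ 1))"
  proof (induction a)
    case 0
    show ?case using const[of 0] by simp
  next
    case (pCons c a)
    show ?case using add[OF const[of c] mult[OF coord(1) pCons.IH]] by simp
  qed
  from add[OF this mult[OF coord(2) pCons.IH]] show ?case
    by (simp add: eval2_pCons)
qed

definition polynomial_function :: "('b::field ^ 2 \<Rightarrow> 'b) \<Rightarrow> bool" where
  "polynomial_function \<phi> \<longleftrightarrow> (\<exists>f. \<forall>P. \<phi> P = eval2 f P)"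

lemma polynomial_function_const: "polynomial_function (\<lambda>_. c)"
  unfolding polynomial_function_def by (rule exI[of _ "[:[:c:]:]"]) simp

lemma polynomial_function_coord:
  "polynomial_function (\<lambda>P. P $ 1)" "polynomial_function (\<lambda>P. P $ 2)"
  unfolding polynomial_function_def
  by (rule exI[of _ "[:[:0, 1:]:]"], simp) (rule exI[of _ "[:0, 1:]"], simp add: eval2_def)

lemma polynomial_function_coord': "polynomial_function (\<lambda>P. P $ i)"
  using polynomial_function_coord exhaust_2[of i] by auto

lemma polynomial_function_add:
  "polynomial_function \<phi> \<Longrightarrow> polynomial_function \<psi> \<Longrightarrow> polynomial_function (\<lambda>P. \<phi> P + \<psi> P)"
  unfolding polynomial_function_def by (metis eval2_add)

lemma polynomial_function_diff:
  "polynomial_function \<phi> \<Longrightarrow> polynomial_function \<psi> \<Longrightarrow> polynomial_function (\<lambda>P. \<phi> P - \<psi> P)"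
  unfolding polynomial_function_def by (metis eval2_diff)

lemma polynomial_function_mult:
  "polynomial_function \<phi> \<Longrightarrow> polynomial_function \<psi> \<Longrightarrow> polynomial_function (\<lambda>P. \<phi> P * \<psi> P)"
  unfolding polynomial_function_def by (metis eval2_mult)

lemma polynomial_function_power:
  "polynomial_function \<phi> \<Longrightarrow> polynomial_function (\<lambda>P. \<phi> P ^ n)"
  by (induction n) (simp_all add: polynomial_function_const polynomial_function_mult)

lemma polynomial_function_norm2_sq:
  "polynomial_function (\<lambda>P. norm2_sq (A - P))"
  unfolding norm2_sq_def vector_minus_component
  by (intro polynomial_function_add polynomial_function_power polynomial_function_diff
      polynomial_function_const polynomial_function_coord)

lemma polynomial_function_eval2:
  fixes u :: "'b::field ^ 2 \<Rightarrow> 'b ^ 2"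
  assumes "\<And>i. polynomial_function (\<lambda>P. u P $ i)"
  shows "polynomial_function (\<lambda>P. eval2 f (u P))"
  by (rule eval2_comp_closed[where T = polynomial_function])
    (fact polynomial_function_const polynomial_function_add polynomial_function_mult assms)+


section \<open>Zariski closed sets\<close>

lemma zariski_closed_zeros:
  assumes "polynomial_function \<phi>"
  shows "zariski_closed {P. \<phi> P = 0}"
proof -
  obtain f where "\<And>P. \<phi> P = eval2 f P" using assms unfolding polynomial_function_def by blast
  then have "{P. \<phi> P = 0} = {P. \<forall>g\<in>{f}. eval2 g P = 0}" by auto
  then show ?thesis unfolding zariski_closed_def by blast
qed

lemma zariski_closed_Int:
  assumes "zariski_closed Y" "zariski_closed Z"
  shows "zariski_closed (Y \<inter> Z)"
proof -
  obtain I J where IJ: "Y = {P. \<forall>f\<in>I. eval2 f P = 0}" "Z = {P. \<forall>f\<in>J. eval2 f P = 0}"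
    using assms unfolding zariski_closed_def by blast
  have "Y \<inter> Z = {P. \<forall>f\<in>I \<union> J. eval2 f P = 0}"
    unfolding IJ by auto
  then show ?thesis unfolding zariski_closed_def by blast
qed

lemma zariski_closed_Un:
  assumes "zariski_closed Y" "zariski_closed Z"
  shows "zariski_closed (Y \<union> Z)"
proof -
  obtain I J where IJ: "Y = {P. \<forall>f\<in>I. eval2 f P = 0}" "Z = {P. \<forall>f\<in>J. eval2 f P = 0}"
    using assms unfolding zariski_closed_def by blast
  have "Y \<union> Z = {P. \<forall>h\<in>(\<lambda>(f, g). f * g) ` (I \<times> J). eval2 h P = 0}"
    unfolding IJ by auto
  then show ?thesis unfolding zariski_closed_def by blast
qed

lemma zariski_closed_singleton: "zariski_closed {A}"
proof -
  have "{A} = {P. P $ 1 - A $ 1 = 0} \<inter> {P. P $ 2 - A $ 2 = 0}"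
    by (auto simp: vec_eq_iff forall_2)
  moreover have "zariski_closed \<dots>"
    by (intro zariski_closed_Int zariski_closed_zeros polynomial_function_diff
        polynomial_function_coord' polynomial_function_const)
  ultimately show ?thesis by simp
qed

lemma zariski_closure_subset: "S \<subseteq> Z \<Longrightarrow> zariski_closed Z \<Longrightarrow> zariski_closure S \<subseteq> Z"
  unfolding zariski_closure_def by (rule hull_minimal)

lemma in_zariski_closureI:
  assumes "\<And>f. (\<And>Q. Q \<in> S \<Longrightarrow> eval2 f Q = 0) \<Longrightarrow> eval2 f P = 0"
  shows "P \<in> zariski_closure S"
  unfolding zariski_closure_def hull_def
proof (intro InterI, elim CollectE conjE)
  fix Z assume "zariski_closed Z" and S: "S \<subseteq> Z"
  then obtain I where I: "Z = {Q. \<forall>f\<in>I. eval2 f Q = 0}"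
    unfolding zariski_closed_def by blast
  have "eval2 f P = 0" if "f \<in> I" for f
    using S that by (intro assms) (auto simp: I)
  then show "P \<in> Z" by (simp add: I)
qed


section \<open>Irreducible polynomials and common zeros\<close>

text \<open>
  Seen as a polynomial in \<open>x\<close> and \<open>y\<close>, this is the restriction of \<open>f\<close> to a vertical line; seen as a
  polynomial over \<open>F[t]\<close>, it is the reduction of the coefficients modulo \<open>t - x\<close>.
\<close>

definition specialize :: "'b::field poly poly \<Rightarrow> 'b \<Rightarrow> 'b poly" where
  "specialize f x = map_poly (\<lambda>c. poly c x) f"

lemma poly_specialize: "poly (specialize f (P $ 1)) (P $ 2) = eval2 f P"
  unfolding specialize_def
  by (induction f) (simp_all add: map_poly_pCons eval2_pCons)

lemma specialize_eq_0_iff: "specialize f x = 0 \<longleftrightarrow> [:[:-x, 1:]:] dvd f"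
  by (auto simp: specialize_def poly_eq_iff coeff_map_poly const_poly_dvd_iff
      poly_eq_0_iff_dvd)

lemma finite_plane_points:
  fixes Y :: "'b::zero \<Rightarrow> 'b set" and U :: "'b set"
  assumes "finite U" "\<And>x. x \<in> U \<Longrightarrow> finite (Y x)"
  shows "finite ({P. P $ 1 \<in> U \<and> P $ 2 \<in> Y (P $ 1)} :: ('b ^ 2) set)"
proof (rule finite_subset)
  show "{P. P $ 1 \<in> U \<and> P $ 2 \<in> Y (P $ 1)} \<subseteq>
      (\<lambda>(x, y). vector [x, y] :: 'b ^ 2) ` (SIGMA x:U. Y x)"
    by (force simp: vec_eq_iff forall_2)
  show "finite ((\<lambda>(x, y). vector [x, y] :: 'b ^ 2) ` (SIGMA x:U. Y x))"
    using assms by auto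
qed

lemma finite_zeros_on_vertical_lines:
  assumes "finite U" "\<And>x. x \<in> U \<Longrightarrow> specialize f x \<noteq> 0"
  shows "finite {P. P $ 1 \<in> U \<and> eval2 f P = 0}"
proof -
  have "{P. P $ 1 \<in> U \<and> eval2 f P = 0} =
      {P. P $ 1 \<in> U \<and> P $ 2 \<in> {y. poly (specialize f (P $ 1)) y = 0}}"
    by (simp add: poly_specialize)
  then show ?thesis
    using finite_plane_points[of U "\<lambda>x. {y. poly (specialize f x) y = 0}"] assms
    by (auto simp: poly_roots_finite)
qed

lemma prime_elem_linear: "prime_elem [:-x, 1 :: 'b::field:]"
proof (rule prime_elemI)
  show "[:-x, 1:] dvd a \<or> [:-x, 1:] dvd b" if "[:-x, 1:] dvd a * b" for a b
    using that by (simp flip: poly_eq_0_iff_dvd)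
qed (auto simp: is_unit_pCons_iff)

text \<open>
  A form of Gauss's lemma. Linear polynomials in \<open>x\<close> are prime in \<open>F[x][y]\<close>, so the linear factors of
  \<open>c\<close> can be cancelled one at a time, each against \<open>q\<close> or against \<open>r\<close>; \<open>c'\<close> collects those that are
  taken from \<open>r\<close>.
\<close>

lemma const_mult_split:
  fixes p q r :: "'b::alg_closed_field poly poly"
  assumes "c \<noteq> 0" "[:c:] * p = q * r"
  shows "\<exists>q' r' c'. p = q' * r' \<and> r = [:c':] * r'"
  using assms
proof (induction "Polynomial.degree c" arbitrary: c q r)
  case 0
  then obtain k where k: "c = [:k:]" "k \<noteq> 0"
    by (metis degree_eq_zeroE pCons_0_0)
  have "[:[:1 / k:]:] * [:c:] = 1" using k by (simp add: one_pCons)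
  then have "p = ([:[:1 / k:]:] * [:c:]) * p" by simp
  also have "\<dots> = ([:[:1 / k:]:] * q) * r"
    using "0.prems"(2) by (metis mult.assoc)
  finally show ?case
    by (intro exI[of _ "[:[:1 / k:]:] * q"] exI[of _ r] exI[of _ 1]) simp
next
  case (Suc n)
  obtain x where "poly c x = 0"
    using alg_closed_imp_poly_has_root[of c] Suc.hyps(2) by auto
  then obtain c' where c: "c = [:-x, 1:] * c'"
    by (auto simp: poly_eq_0_iff_dvd)
  let ?l = "[:-x, 1:] :: 'b poly"
  have c'0: "c' \<noteq> 0" using Suc.prems c by auto
  have "Polynomial.degree c = Polynomial.degree ?l + Polynomial.degree c'"
    unfolding c using c'0 by (intro degree_mult_eq) auto
  then have deg: "n = Polynomial.degree c'" using Suc.hyps(2) by simp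
  have eq: "[:?l:] * ([:c':] * p) = q * r"
    using Suc.prems(2) by (simp add: c mult_ac flip: mult.assoc)
  have "prime_elem [:?l:]" by (rule lift_prime_elem_poly[OF prime_elem_linear])
  moreover have "[:?l:] dvd q * r" using eq by (metis dvd_triv_left)
  ultimately have "[:?l:] dvd q \<or> [:?l:] dvd r"
    using prime_elem_dvd_mult_iff by blast
  then show ?case
  proof
    assume "[:?l:] dvd q"
    then obtain q1 where "q = [:?l:] * q1" ..
    with eq have "[:?l:] * ([:c':] * p) = [:?l:] * (q1 * r)" by (simp only: mult.assoc)
    then have "[:c':] * p = q1 * r" by (subst (asm) mult_left_cancel) auto
    from Suc.hyps(1)[OF deg c'0 this] show ?thesis .
  next
    assume "[:?l:] dvd r"
    then obtain r1 where r1: "r = [:?l:] * r1" ..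
    with eq have "[:?l:] * ([:c':] * p) = [:?l:] * (q * r1)" by (simp only: mult_ac)
    then have "[:c':] * p = q * r1" by (subst (asm) mult_left_cancel) auto
    from Suc.hyps(1)[OF deg c'0 this] obtain q' r' d
      where "p = q' * r'" "r1 = [:d:] * r'" by blast
    then show ?thesis unfolding r1
      by (intro exI[of _ q'] exI[of _ r'] exI[of _ "?l * d"])
        (simp only: mult.assoc[symmetric], simp)
  qed
qed


lemma irreducible_dvd_const_mult:
  fixes p :: "'b::alg_closed_field poly poly"
  assumes p: "Factorial_Ring.irreducible p" "Polynomial.degree p > 0"
    and c: "c \<noteq> 0" "p dvd [:c:] * q"
  shows "p dvd q"
proof -
  obtain u where "[:c:] * q = u * p" using c(2) by (metis dvd_def mult.commute)
  with const_mult_split[OF c(1)] obtain q' r' c' where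
    *: "q = q' * r'" "p = [:c':] * r'" by blast
  have "is_unit [:c':]"
  proof (rule ccontr)
    assume "\<not> is_unit [:c':]"
    with p(1) * have "is_unit r'" unfolding irreducible_def by blast
    then obtain k where "r' = [:k:]" by (auto simp: is_unit_poly_iff)
    with * p(2) show False by simp
  qed
  then have "p dvd r'" unfolding *(2) by (subst mult_unit_dvd_iff') simp_all
  with * show ?thesis by simp
qed

lemma irreducible_linear_dvd:
  fixes p :: "'b::alg_closed_field poly poly"
  assumes "Factorial_Ring.irreducible p" "[:[:-x, 1:]:] dvd p"
  shows "p dvd [:[:-x, 1:]:]"
proof -
  have "\<not> is_unit [:[:-x, 1:]:]" by (simp add: is_unit_const_poly_iff is_unit_pCons_iff)
  moreover obtain u where u: "p = [:[:-x, 1:]:] * u" using assms(2) ..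
  ultimately have "is_unit u" using assms(1) unfolding irreducible_def by blast
  then show ?thesis unfolding u by (subst mult_unit_dvd_iff) simp_all
qed

text \<open>
  A weak Bezout theorem. Take an element \<open>r\<close> of least degree in \<open>y\<close> in the ideal generated by \<open>p\<close> and
  \<open>W\<close>. By pseudo-division it divides \<open>p\<close> and \<open>W\<close> up to factors from \<open>F[x]\<close>, so by Gauss's
  lemma, since \<open>p\<close> is irreducible and does not divide \<open>W\<close>, \<open>r\<close> lies in \<open>F[x]\<close>. Then common zeros have one of
  finitely many abscissas, and \<open>p\<close> vanishes identically on no vertical line, unless \<open>p\<close> itself is a
  linear polynomial in \<open>x\<close>, which is treated first.
\<close>

lemma finite_common_zeros:
  fixes p W :: "'b::alg_closed_field poly poly"
  assumes p: "Factorial_Ring.irreducible p" and ndvd: "\<not> p dvd W"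
  shows "finite {P. eval2 p P = 0 \<and> eval2 W P = 0}"
proof (cases "Polynomial.degree p = 0")
  case True
  then obtain q where q: "p = [:q:]" by (rule degree_eq_zeroE)
  have "Polynomial.degree q \<noteq> 0"
  proof
    assume "Polynomial.degree q = 0"
    then obtain k where "q = [:k:]" by (rule degree_eq_zeroE)
    with p q show False by (auto simp: irreducible_def is_unit_const_poly_iff is_unit_pCons_iff)
  qed
  then obtain x where "poly q x = 0"
    using alg_closed_imp_poly_has_root[of q] by auto
  then have "[:[:-x, 1:]:] dvd p" by (simp add: q poly_eq_0_iff_dvd)
  with irreducible_linear_dvd[OF p] have l: "p dvd [:[:-x, 1:]:]" "[:[:-x, 1:]:] dvd p" by auto
  have "specialize W x \<noteq> 0"
    unfolding specialize_eq_0_iff using l ndvd dvd_trans by blast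
  then have "finite {P. P $ 1 \<in> {x} \<and> eval2 W P = 0}"
    by (intro finite_zeros_on_vertical_lines) auto
  moreover have "P $ 1 = x" if "eval2 p P = 0" for P
  proof -
    from l(1) obtain u where "[:[:-x, 1:]:] = p * u" ..
    then have "eval2 [:[:-x, 1:]:] P = 0" using that by simp
    then show ?thesis by simp
  qed
  ultimately show ?thesis by (elim rev_finite_subset) auto
next
  case deg: False
  define I where "I = {r. \<exists>a b. r = a * p + b * W}"
  have pI: "p \<in> I" and WI: "W \<in> I"
    unfolding I_def by (auto intro: exI[of _ 1] exI[of _ 0])
  have p0: "p \<noteq> 0" using p by auto
  from p0 pI have "\<exists>r. r \<in> I \<and> r \<noteq> 0" by blast
  then obtain r where r: "r \<in> I" "r \<noteq> 0"
    and min: "\<And>g. g \<in> I \<Longrightarrow> g \<noteq> 0 \<Longrightarrow> Polynomial.degree r \<le> Polynomial.degree g"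
    using ex_has_least_nat[of "\<lambda>r. r \<in> I \<and> r \<noteq> 0" _ Polynomial.degree] by blast
  have comb: "[:a:] * g - q * h \<in> I" if gh: "g \<in> I" "h \<in> I" for a q g h
  proof -
    obtain a1 b1 a2 b2 where "g = a1 * p + b1 * W" "h = a2 * p + b2 * W"
      using gh unfolding I_def by blast
    then have "[:a:] * g - q * h =
        ([:a:] * a1 - q * a2) * p + ([:a:] * b1 - q * b2) * W"
      by (simp only: algebra_simps)
    then show ?thesis unfolding I_def by blast
  qed
  have div: "\<exists>a q. a \<noteq> 0 \<and> [:a:] * g = q * r" if "g \<in> I" for g
  proof -
    obtain a q where aq: "a \<noteq> 0" "Polynomial.smult a g = r * q + pseudo_mod g r"
      using pseudo_mod(1)[OF r(2)] by blast
    then have "pseudo_mod g r = [:a:] * g - q * r" by (simp add: algebra_simps)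
    then have "pseudo_mod g r \<in> I" using comb[OF that r(1)] by simp
    then have "pseudo_mod g r = 0"
      using pseudo_mod(2)[OF r(2), of g] min[of "pseudo_mod g r"] by fastforce
    then show ?thesis using aq by (auto simp: mult.commute)
  qed
  obtain a q where aq: "a \<noteq> 0" "[:a:] * p = q * r" using div[OF pI] by blast
  obtain q1 r1 c1 where s: "p = q1 * r1" "r = [:c1:] * r1"
    using const_mult_split[OF aq] by blast
  have "\<not> is_unit q1"
  proof
    assume "is_unit q1"
    then have "p dvd r1" unfolding s(1) by (subst mult_unit_dvd_iff') simp_all
    then have "p dvd r" unfolding s(2) by (rule dvd_mult)
    obtain b q' where bq: "b \<noteq> 0" "[:b:] * W = q' * r" using div[OF WI] by blast
    from \<open>p dvd r\<close> have "p dvd [:b:] * W" unfolding bq(2) by simp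
    then show False using irreducible_dvd_const_mult[OF p] deg bq(1) ndvd by simp
  qed
  with p s(1) have "is_unit r1" unfolding irreducible_def by blast
  then obtain k where "r1 = [:k:]" by (auto simp: is_unit_poly_iff)
  then obtain c where c: "r = [:c:]" "c \<noteq> 0" using s(2) r(2) by auto
  have "poly c (P $ 1) = 0" if "eval2 p P = 0" "eval2 W P = 0" for P
  proof -
    obtain a b where "r = a * p + b * W" using r(1) unfolding I_def by blast
    then have "eval2 r P = 0" using that by simp
    then show ?thesis unfolding c(1) by simp
  qed
  moreover have "finite {P. P $ 1 \<in> {x. poly c x = 0} \<and> eval2 p P = 0}"
  proof (rule finite_zeros_on_vertical_lines)
    show "finite {x. poly c x = 0}" using c(2) by (rule poly_roots_finite)
    show "specialize p x \<noteq> 0" for x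
    proof
      assume "specialize p x = 0"
      then have "p dvd [:[:-x, 1:]:]"
        unfolding specialize_eq_0_iff by (rule irreducible_linear_dvd[OF p])
      then have "Polynomial.degree p \<le> Polynomial.degree [:[:-x, 1:]:]"
        by (rule dvd_imp_degree_le) simp
      with deg show False by simp
    qed
  qed
  ultimately show ?thesis by (elim rev_finite_subset) auto
qed

text \<open>
  \<open>H'\<close> is the product of those irreducible factors of \<open>H\<close> that do not divide \<open>W\<close>: removing from the
  curve of \<open>H\<close> the components on which \<open>W\<close> vanishes changes nothing outside the zeros of \<open>W\<close>, and the
  other components meet those zeros in finitely many points.
\<close>

lemma closed_part_outside:
  fixes H W :: "'b::alg_closed_field poly poly"
  assumes "H \<noteq> 0"
  obtains H' where "\<And>P. eval2 H P = 0 \<Longrightarrow> eval2 W P \<noteq> 0 \<Longrightarrow> eval2 H' P = 0"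
    and "\<And>P. eval2 H' P = 0 \<Longrightarrow> eval2 H P = 0"
    and "finite {P. eval2 H' P = 0 \<and> eval2 W P = 0}"
proof -
  \<comment> \<open>The measure \<open>\<mu>\<close> is additive on products and zero exactly on units, so an induction on it
      replaces unique factorization.\<close>
  define \<mu> where "\<mu> g = Polynomial.degree g + Polynomial.degree (Polynomial.lead_coeff g)"
    for g :: "'b poly poly"
  have \<mu>_mult: "\<mu> (g * h) = \<mu> g + \<mu> h" if "g \<noteq> 0" "h \<noteq> 0" for g h
    unfolding \<mu>_def lead_coeff_mult using that by (subst (1 2) degree_mult_eq) auto
  have unit: "is_unit g" if g: "g \<noteq> 0" and "\<mu> g = 0" for g
  proof -
    have "Polynomial.degree g = 0" using that by (simp add: \<mu>_def)
    then obtain q where q: "g = [:q:]" by (rule degree_eq_zeroE)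
    then have "Polynomial.degree q = 0" using that by (simp add: \<mu>_def)
    then obtain k where "q = [:k:]" by (rule degree_eq_zeroE)
    with q g show ?thesis by (simp add: is_unit_const_poly_iff is_unit_pCons_iff)
  qed
  have "\<exists>H'. (\<forall>P. eval2 H P = 0 \<longrightarrow> eval2 W P \<noteq> 0 \<longrightarrow> eval2 H' P = 0) \<and>
      (\<forall>P. eval2 H' P = 0 \<longrightarrow> eval2 H P = 0) \<and> finite {P. eval2 H' P = 0 \<and> eval2 W P = 0}"
    using assms
  proof (induction "\<mu> H" arbitrary: H rule: less_induct)
    case less
    consider "is_unit H" | "Factorial_Ring.irreducible H" "\<not> H dvd W"
      | "Factorial_Ring.irreducible H" "H dvd W"
      | g h where "H = g * h" "\<not> is_unit g" "\<not> is_unit h"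
      using less.prems unfolding irreducible_def by blast
    then show ?case
    proof cases
      case 1
      then obtain g where "1 = H * g" ..
      then have "eval2 H P * eval2 g P = 1" for P 
        by (simp flip: eval2_mult)
      then have "eval2 H P \<noteq> 0" for P by (metis mult_zero_left zero_neq_one)
      then show ?thesis by (intro exI[of _ H]) auto
    next
      case 2
      then show ?thesis by (intro exI[of _ H]) (auto intro: finite_common_zeros)
    next
      case 3
      then obtain g where "W = H * g" by (elim dvdE)
      then have "eval2 W P = 0" if "eval2 H P = 0" for P
        using that by simp
      then show ?thesis by (intro exI[of _ 1]) auto
    next
      case 4
      then have nz: "g \<noteq> 0" "h \<noteq> 0" using less.prems by auto
      then have "\<mu> g > 0" "\<mu> h > 0" using unit 4 by auto
      then have lt: "\<mu> g < \<mu> H" "\<mu> h < \<mu> H" using \<mu>_mult[OF nz] 4 by auto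
      obtain g' where g': "\<And>P. eval2 g P = 0 \<Longrightarrow> eval2 W P \<noteq> 0 \<Longrightarrow> eval2 g' P = 0"
        "\<And>P. eval2 g' P = 0 \<Longrightarrow> eval2 g P = 0" "finite {P. eval2 g' P = 0 \<and> eval2 W P = 0}"
        using less.hyps[OF lt(1) nz(1)] by blast
      obtain h' where h': "\<And>P. eval2 h P = 0 \<Longrightarrow> eval2 W P \<noteq> 0 \<Longrightarrow> eval2 h' P = 0"
        "\<And>P. eval2 h' P = 0 \<Longrightarrow> eval2 h P = 0" "finite {P. eval2 h' P = 0 \<and> eval2 W P = 0}"
        using less.hyps[OF lt(2) nz(2)] by blast
      have "{P. eval2 (g' * h') P = 0 \<and> eval2 W P = 0} =
        {P. eval2 g' P = 0 \<and> eval2 W P = 0} \<union> {P. eval2 h' P = 0 \<and> eval2 W P = 0}" by auto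
      then show ?thesis using g' h' 4(1) by (intro exI[of _ "g' * h'"]) auto
    qed
  qed
  then show ?thesis using that by blast
qed


section \<open>The points swept out by the conchoid construction\<close>

definition conchoid_points :: "('b::field ^ 2) set \<Rightarrow> 'b ^ 2 \<Rightarrow> 'b \<Rightarrow> ('b ^ 2) set" where
  "conchoid_points C A d =
     {P + (d / s) *s (A - P) | P s. P \<in> C \<and> s\<^sup>2 = norm2_sq (A - P) \<and> s \<noteq> 0}"

lemma conchoid_pointsI:
  "P \<in> C \<Longrightarrow> s\<^sup>2 = norm2_sq (A - P) \<Longrightarrow> s \<noteq> 0 \<Longrightarrow> P + (d / s) *s (A - P) \<in> conchoid_points C A d"
  unfolding conchoid_points_def by blast

text \<open>Replacing \<open>s\<close> by \<open>- s\<close> exchanges the two points obtained from \<open>P\<close>, so one sign suffices.\<close>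

lemma conchoid_eq: "conchoid C A d = zariski_closure (conchoid_points C A d)"
proof -
  have "P - (d / s) *s (A - P) = P + (d / - s) *s (A - P)" for P s
    by (simp add: vec_eq_iff)
  then have "P - (d / s) *s (A - P) \<in> conchoid_points C A d"
    if "P \<in> C" "s\<^sup>2 = norm2_sq (A - P)" "s \<noteq> 0" for P s
    using conchoid_pointsI[of P C "- s" A d] that by simp
  then have "{Q. \<exists>P\<in>C. \<exists>s. s\<^sup>2 = norm2_sq (A - P) \<and> s \<noteq> 0 \<and>
           (Q = P + (d / s) *s (A - P) \<or> Q = P - (d / s) *s (A - P))} = conchoid_points C A d"
    by (auto simp: conchoid_points_def)
  then show ?thesis by (simp add: conchoid_def)
qed

lemma norm2_sq_scale: "norm2_sq (c *s v) = c\<^sup>2 * norm2_sq v"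
  by (simp add: norm2_sq_def power_mult_distrib algebra_simps)

text \<open>
  The construction is its own inverse up to the sign of \<open>d\<close>: if \<open>s\<close> is the distance from \<open>A\<close> to \<open>P\<close>,
  then \<open>r = s - d\<close> is, up to sign, the distance from \<open>A\<close> to \<open>Q\<close>, and \<open>P\<close> is recovered from \<open>Q\<close> and
  \<open>r\<close>. Only \<open>s = d\<close> is lost: all such \<open>P\<close> are sent to \<open>A\<close>.
\<close>

lemma conchoid_points_inverse:
  assumes "Q \<in> conchoid_points C A d"
  shows "Q = A \<or> (\<exists>r. r \<noteq> 0 \<and> r + d \<noteq> 0 \<and> r\<^sup>2 = norm2_sq (A - Q) \<and> Q - (d / r) *s (A - Q) \<in> C)"
proof -
  obtain P s where P: "Q = P + (d / s) *s (A - P)" "P \<in> C" "s\<^sup>2 = norm2_sq (A - P)" "s \<noteq> 0"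
    using assms unfolding conchoid_points_def by blast
  show ?thesis
  proof (cases "s = d")
    case True
    then show ?thesis using P(1,4) by simp
  next
    case False
    have AQ: "A - Q = ((s - d) / s) *s (A - P)"
      using P(4) unfolding P(1) by (simp add: vec_eq_iff field_simps)
    have "(s - d)\<^sup>2 = norm2_sq (A - Q)"
      unfolding AQ norm2_sq_scale P(3)[symmetric] using P(4) by (simp add: field_simps)
    moreover have "Q - (d / (s - d)) *s (A - Q) = P"
      unfolding AQ using False P(4) by (simp add: P(1) vec_eq_iff)
    ultimately show ?thesis
      using False P(2,4) by (intro disjI2 exI[of _ "s - d"]) simp
  qed
qed

lemma conchoid_pointsI_inverse:
  assumes r: "r \<noteq> 0" "r + d \<noteq> 0" "r\<^sup>2 = norm2_sq (A - Q)"
    and C: "Q - (d / r) *s (A - Q) \<in> C"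
  shows "Q \<in> conchoid_points C A d"
proof -
  define P where "P = Q - (d / r) *s (A - Q)"
  have AP: "A - P = ((r + d) / r) *s (A - Q)"
    using r(1) unfolding P_def by (simp add: vec_eq_iff field_simps)
  have "(r + d)\<^sup>2 = norm2_sq (A - P)"
    unfolding AP norm2_sq_scale r(3)[symmetric] using r(1) by (simp add: field_simps)
  then have "P + (d / (r + d)) *s (A - P) \<in> conchoid_points C A d"
    using r(2) C by (intro conchoid_pointsI) (auto simp: P_def)
  moreover have "P + (d / (r + d)) *s (A - P) = Q"
    unfolding AP using r(1,2) by (simp add: P_def vec_eq_iff)
  ultimately show ?thesis by simp
qed


section \<open>The closure adds finitely many points\<close>

lemma eval2_eq_0_imp:
  fixes f :: "'b::field_char_0 poly poly"
  assumes "\<And>P. eval2 f P = 0"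
  shows "f = 0"
proof -
  have "specialize f x = 0" for x
  proof -
    have "poly (specialize f x) y = 0" for y
      using poly_specialize[of f "vector [x, y] :: 'b ^ 2"] assms by simp
    then show ?thesis using poly_all_0_iff_0 by blast
  qed
  then have "poly (poly.coeff f n) x = 0" for n x
    by (simp add: specialize_eq_0_iff const_poly_dvd_iff poly_eq_0_iff_dvd)
  then have "poly.coeff f n = 0" for n using poly_all_0_iff_0 by blast
  then show ?thesis by (simp add: poly_eq_iff)
qed

text \<open>
  With \<open>r\<close> standing for a square root of \<open>N Q\<close>: after clearing a power of \<open>N\<close> from the denominator,
  \<open>\<phi>\<close> has the form \<open>g + r h\<close> with \<open>g\<close> and \<open>h\<close> polynomial in \<open>Q\<close>, the same for both roots \<open>r\<close>.
\<close>

definition linear_in_sqrt :: "('b::field ^ 2 \<Rightarrow> 'b) \<Rightarrow> (('b ^ 2) \<times> 'b \<Rightarrow> 'b) \<Rightarrow> bool" where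
  "linear_in_sqrt N \<phi> \<longleftrightarrow> (\<exists>n g h. polynomial_function g \<and> polynomial_function h \<and>
     (\<forall>Q r. r \<noteq> 0 \<longrightarrow> r\<^sup>2 = N Q \<longrightarrow> N Q ^ n * \<phi> (Q, r) = g Q + r * h Q))"

lemma linear_in_sqrtI:
  assumes "polynomial_function g" "polynomial_function h"
    "\<And>Q r. r \<noteq> 0 \<Longrightarrow> r\<^sup>2 = N Q \<Longrightarrow> N Q ^ n * \<phi> (Q, r) = g Q + r * h Q"
  shows "linear_in_sqrt N \<phi>"
  unfolding linear_in_sqrt_def using assms by blast

lemma linear_in_sqrt_eval2:
  fixes N :: "'b::field ^ 2 \<Rightarrow> 'b"
  assumes N: "polynomial_function N"
  shows "linear_in_sqrt N (\<lambda>(Q, r). eval2 f (Q - (d / r) *s (A - Q)))"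
proof -
  let ?T = "linear_in_sqrt N"
  let ?u = "\<lambda>(Q, r). Q - (d / r) *s (A - Q) :: 'b ^ 2"
  have "?T (\<lambda>i. eval2 f (?u i))"
  proof (rule eval2_comp_closed[where T = ?T])
    show "?T (\<lambda>_. c)" for c
      by (rule linear_in_sqrtI[where n = 0 and g = "\<lambda>_. c" and h = "\<lambda>_. 0"])
        (simp_all add: polynomial_function_const)
  next
    fix \<phi> \<psi> assume "?T \<phi>" "?T \<psi>"
    then obtain n g h m k l where pf: "polynomial_function g" "polynomial_function h"
        "polynomial_function k" "polynomial_function l"
      and eq: "\<And>Q r. r \<noteq> 0 \<Longrightarrow> r\<^sup>2 = N Q \<Longrightarrow> N Q ^ n * \<phi> (Q, r) = g Q + r * h Q"
        "\<And>Q r. r \<noteq> 0 \<Longrightarrow> r\<^sup>2 = N Q \<Longrightarrow> N Q ^ m * \<psi> (Q, r) = k Q + r * l Q"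
      unfolding linear_in_sqrt_def by metis
    have sum: "N Q ^ (n + m) * (\<phi> (Q, r) + \<psi> (Q, r)) =
        (N Q ^ m * g Q + N Q ^ n * k Q) + r * (N Q ^ m * h Q + N Q ^ n * l Q)"
      if "r \<noteq> 0" "r\<^sup>2 = N Q" for Q r
    proof -
      have "N Q ^ (n + m) * (\<phi> (Q, r) + \<psi> (Q, r)) =
          N Q ^ m * (N Q ^ n * \<phi> (Q, r)) + N Q ^ n * (N Q ^ m * \<psi> (Q, r))"
        by (simp add: power_add algebra_simps)
      then show ?thesis unfolding eq[OF that] by (simp add: algebra_simps)
    qed
    show "?T (\<lambda>i. \<phi> i + \<psi> i)"
      by (rule linear_in_sqrtI[where \<phi> = "\<lambda>i. \<phi> i + \<psi> i", OF _ _ sum])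
        (intro polynomial_function_add polynomial_function_mult polynomial_function_power N pf)+
    have prod: "N Q ^ (n + m) * (\<phi> (Q, r) * \<psi> (Q, r)) =
        (g Q * k Q + N Q * (h Q * l Q)) + r * (g Q * l Q + h Q * k Q)"
      if "r \<noteq> 0" "r\<^sup>2 = N Q" for Q r
    proof -
      have "N Q ^ (n + m) * (\<phi> (Q, r) * \<psi> (Q, r)) =
          (N Q ^ n * \<phi> (Q, r)) * (N Q ^ m * \<psi> (Q, r))"
        by (simp add: power_add algebra_simps)
      also have "\<dots> = (g Q * k Q + r\<^sup>2 * (h Q * l Q)) + r * (g Q * l Q + h Q * k Q)"
        unfolding eq[OF that] by (simp add: algebra_simps power2_eq_square)
      finally show ?thesis unfolding that(2) .
    qed
    show "?T (\<lambda>i. \<phi> i * \<psi> i)"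
      by (rule linear_in_sqrtI[where \<phi> = "\<lambda>i. \<phi> i * \<psi> i", OF _ _ prod])
        (intro polynomial_function_add polynomial_function_mult polynomial_function_power N pf)+
  next
    have "?T (\<lambda>p. ?u p $ i)" for i
    proof (rule linear_in_sqrtI[where n = 1 and g = "\<lambda>Q. N Q * Q $ i"
          and h = "\<lambda>Q. (- d) * (A $ i - Q $ i)"])
      show "N Q ^ 1 * ((case (Q, r) of (Q, r) \<Rightarrow> Q - (d / r) *s (A - Q)) $ i) =
          N Q * Q $ i + r * (- d * (A $ i - Q $ i))" if "r \<noteq> 0" "r\<^sup>2 = N Q" for Q r
        using that(1) unfolding that(2)[symmetric] by (simp add: field_simps power2_eq_square)
    qed (intro polynomial_function_mult polynomial_function_diff N
        polynomial_function_const polynomial_function_coord')+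
    then show "?T (\<lambda>p. ?u p $ 1)" "?T (\<lambda>p. ?u p $ 2)" by blast+
  qed
  then show ?thesis by (simp add: case_prod_unfold)
qed

text \<open>
  The norm of the equation of the conchoid. The equation \<open>f = 0\<close> for the point that \<open>Q\<close> comes from
  involves a square root \<open>r\<close>; multiplying \<open>g + r h\<close> by its conjugate \<open>g - r h\<close> eliminates it.
\<close>

lemma conjugate_product:
  fixes A :: "'b::field ^ 2"
  obtains H n where "\<And>Q r. r \<noteq> 0 \<Longrightarrow> r\<^sup>2 = norm2_sq (A - Q) \<Longrightarrow>
    eval2 H Q = norm2_sq (A - Q) ^ n *
      (eval2 f (Q - (d / r) *s (A - Q)) * eval2 f (Q + (d / r) *s (A - Q)))"
proof -
  let ?N = "\<lambda>Q. norm2_sq (A - Q)"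
  obtain n g h where gh: "polynomial_function g" "polynomial_function h"
    and eq: "\<And>Q r. r \<noteq> 0 \<Longrightarrow> r\<^sup>2 = ?N Q \<Longrightarrow>
      ?N Q ^ n * eval2 f (Q - (d / r) *s (A - Q)) = g Q + r * h Q"
    using linear_in_sqrt_eval2[OF polynomial_function_norm2_sq, of A f d A]
    unfolding linear_in_sqrt_def by auto
  have "polynomial_function (\<lambda>Q. g Q * g Q - ?N Q * (h Q * h Q))"
    by (intro polynomial_function_diff polynomial_function_mult polynomial_function_norm2_sq gh)
  then obtain H where H: "\<And>Q. g Q * g Q - ?N Q * (h Q * h Q) = eval2 H Q"
    by (auto simp: polynomial_function_def)
  have "eval2 H Q = ?N Q ^ (n + n) *
      (eval2 f (Q - (d / r) *s (A - Q)) * eval2 f (Q + (d / r) *s (A - Q)))"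
    if r: "r \<noteq> 0" "r\<^sup>2 = ?N Q" for Q r
  proof -
    have minus: "Q + (d / r) *s (A - Q) = Q - (d / - r) *s (A - Q)"
      by (simp add: vec_eq_iff)
    have "eval2 H Q = (g Q + r * h Q) * (g Q + - r * h Q)"
      unfolding H[symmetric] r(2)[symmetric] by (simp add: algebra_simps power2_eq_square)
    also have "\<dots> = (?N Q ^ n * eval2 f (Q - (d / r) *s (A - Q))) *
        (?N Q ^ n * eval2 f (Q + (d / r) *s (A - Q)))"
      unfolding minus using r by (subst (1 2) eq) auto
    finally show ?thesis by (simp add: power_add mult_ac)
  qed
  then show ?thesis by (rule that)
qed

text \<open>
  This shows that the norm of the equation is not the zero polynomial. On a line through \<open>A\<close> and a
  point off the curve of \<open>f\<close>, whose direction \<open>e\<close> is normalized to \<open>norm2_sq e = 1\<close>, the distance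
  to \<open>A\<close> is the parameter \<open>x\<close>. Hence \<open>f\<close> becomes a nonzero univariate polynomial \<open>g\<close> there, and it
  suffices that \<open>g\<close> is nonzero at \<open>x + d\<close> and \<open>x - d\<close>.
\<close>

lemma ray_avoiding_zeros:
  fixes f :: "'b::{alg_closed_field, field_char_0} poly poly"
  assumes "f \<noteq> 0"
  obtains Q r where "r \<noteq> 0" "r\<^sup>2 = norm2_sq (A - Q)"
    "eval2 f (Q - (d / r) *s (A - Q)) \<noteq> 0" "eval2 f (Q + (d / r) *s (A - Q)) \<noteq> 0"
proof -
  obtain n where n: "\<And>P. norm2_sq (A - P) = eval2 n P"
    using polynomial_function_norm2_sq[of A] by (auto simp: polynomial_function_def)
  have "norm2_sq (A - (A + vector [1, 0])) = 1"
    by (simp add: norm2_sq_def)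
  then have "n \<noteq> 0" using n by (metis eval2_0 zero_neq_one)
  with assms have "f * n \<noteq> 0" by simp
  then obtain P where P: "eval2 f P \<noteq> 0" "norm2_sq (A - P) \<noteq> 0"
    using eval2_eq_0_imp[of "f * n"] by (auto simp: n)
  obtain s where s: "s\<^sup>2 = norm2_sq (A - P)"
    using nth_root_exists[of 2] by auto
  with P have s0: "s \<noteq> 0" by auto
  define e where "e = (1 / s) *s (P - A)"
  have "norm2_sq (P - A) = norm2_sq (A - P)"
    by (simp add: norm2_sq_def power2_commute)
  then have e: "norm2_sq e = 1"
    unfolding e_def norm2_sq_scale using s[symmetric] s0 by (simp add: field_simps)
  have "\<exists>g. (\<lambda>x. eval2 f (A + x *s e)) = poly g"
  proof (rule eval2_comp_closed[where T = "\<lambda>\<phi>. \<exists>g. \<phi> = poly g"])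
    show "\<exists>g. (\<lambda>_. c) = poly g" for c :: 'b
      by (rule exI[of _ "[:c:]"]) auto
    show "\<exists>g. (\<lambda>x. (A + x *s e) $ 1) = poly g"
      by (rule exI[of _ "[:A $ 1, e $ 1:]"]) auto
    show "\<exists>g. (\<lambda>x. (A + x *s e) $ 2) = poly g"
      by (rule exI[of _ "[:A $ 2, e $ 2:]"]) auto
  next
    fix \<phi> \<psi> :: "'b \<Rightarrow> 'b" assume "\<exists>g. \<phi> = poly g" "\<exists>g. \<psi> = poly g"
    then obtain g h where gh: "\<phi> = poly g" "\<psi> = poly h" by blast
    show "\<exists>g. (\<lambda>i. \<phi> i + \<psi> i) = poly g"
      unfolding gh by (rule exI[of _ "g + h"]) auto
    show "\<exists>g. (\<lambda>i. \<phi> i * \<psi> i) = poly g"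
      unfolding gh by (rule exI[of _ "g * h"]) auto
  qed
  then obtain g where "(\<lambda>x. eval2 f (A + x *s e)) = poly g" ..
  then have g: "eval2 f (A + x *s e) = poly g x" for x by metis
  have "A + s *s e = P" unfolding e_def using s0 by (simp add: vec_eq_iff)
  then have "g \<noteq> 0" using g[of s] P(1) by auto
  then have "finite ({0} \<union> (\<lambda>x. x - d) ` {x. poly g x = 0} \<union> (\<lambda>x. x + d) ` {x. poly g x = 0})"
    by (simp add: poly_roots_finite)
  from ex_new_if_finite[OF infinite_UNIV_char_0 this]
  obtain x where "x \<notin> {0} \<union> (\<lambda>x. x - d) ` {x. poly g x = 0} \<union> (\<lambda>x. x + d) ` {x. poly g x = 0}"
    by (elim exE)
  then have x: "x \<noteq> 0" "poly g (x + d) \<noteq> 0" "poly g (x - d) \<noteq> 0"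
    by (auto simp: image_iff algebra_simps)
  have "A - (A + x *s e) = (- x) *s e" by (simp add: vec_eq_iff)
  then have sq: "x\<^sup>2 = norm2_sq (A - (A + x *s e))"
    by (simp only: norm2_sq_scale e) simp
  have ends: "(A + x *s e) - (d / x) *s (A - (A + x *s e)) = A + (x + d) *s e"
    "(A + x *s e) + (d / x) *s (A - (A + x *s e)) = A + (x - d) *s e"
    using x(1) by (simp_all add: vec_eq_iff algebra_simps)
  show ?thesis
    by (rule that[OF x(1) sq]) (simp_all only: ends g x(2,3) not_False_eq_True)
qed

text \<open>
  Let \<open>N\<close> be the squared distance to \<open>A\<close> and \<open>W = N (N - d\<^sup>2)\<close>. Outside the zeros of \<open>W\<close> the swept
  points are exactly the zeros of the norm \<open>H\<close>, because \<open>N Q \<noteq> 0\<close> allows the construction to be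
  inverted and \<open>N Q \<noteq> d\<^sup>2\<close> excludes \<open>s = 0\<close>. On the zeros of \<open>W\<close> every swept point other than \<open>A\<close> has
  \<open>s = 2 d\<close>, that is, comes from \<open>P = 2 Q - A\<close> at squared distance \<open>4 d\<^sup>2\<close>; these points form a closed
  set \<open>M\<close>. After the components of \<open>H\<close> inside the zeros of \<open>W\<close> have been discarded, only finitely many
  points can be added by the closure.
\<close>

lemma finite_conchoid_minus_points:
  fixes A :: "'b::{alg_closed_field, field_char_0} ^ 2"
  assumes C: "C = {P. eval2 f P = 0}" and f: "f \<noteq> 0" and d: "d \<noteq> 0"
  shows "finite (conchoid C A d - conchoid_points C A d)"
proof -
  let ?B = "conchoid_points C A d" and ?N = "\<lambda>Q. norm2_sq (A - Q)"
  obtain H n where H: "\<And>Q r. r \<noteq> 0 \<Longrightarrow> r\<^sup>2 = ?N Q \<Longrightarrow>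
    eval2 H Q = ?N Q ^ n *
      (eval2 f (Q - (d / r) *s (A - Q)) * eval2 f (Q + (d / r) *s (A - Q)))"
    using conjugate_product[where A = A and f = f and d = d] by blast
  obtain Q0 r0 where Q0: "r0 \<noteq> 0" "r0\<^sup>2 = ?N Q0"
      "eval2 f (Q0 - (d / r0) *s (A - Q0)) \<noteq> 0" "eval2 f (Q0 + (d / r0) *s (A - Q0)) \<noteq> 0"
    using ray_avoiding_zeros[OF f, where A = A and d = d] by blast
  have "?N Q0 \<noteq> 0" unfolding Q0(2)[symmetric] using Q0(1) by simp
  then have "eval2 H Q0 \<noteq> 0" using H[OF Q0(1,2)] Q0(3,4) by simp
  then have H0: "H \<noteq> 0" by auto
  have "polynomial_function (\<lambda>Q. ?N Q * (?N Q - d\<^sup>2))"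
    by (intro polynomial_function_diff polynomial_function_mult polynomial_function_norm2_sq
        polynomial_function_const)
  then obtain W where W: "\<And>Q. ?N Q * (?N Q - d\<^sup>2) = eval2 W Q"
    by (auto simp: polynomial_function_def)
  obtain H' where H': "\<And>P. eval2 H P = 0 \<Longrightarrow> eval2 W P \<noteq> 0 \<Longrightarrow> eval2 H' P = 0"
      "\<And>P. eval2 H' P = 0 \<Longrightarrow> eval2 H P = 0" "finite {P. eval2 H' P = 0 \<and> eval2 W P = 0}"
    using closed_part_outside[OF H0] by blast
  have outside: "Q \<in> ?B" if "eval2 H' Q = 0" "eval2 W Q \<noteq> 0" for Q
  proof -
    obtain r where r: "r\<^sup>2 = ?N Q" using nth_root_exists[of 2] by auto
    have N: "?N Q \<noteq> 0" "?N Q \<noteq> d\<^sup>2" using that(2) by (auto simp: W[symmetric])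
    then have r0: "r \<noteq> 0" "r + d \<noteq> 0" "- r + d \<noteq> 0"
      using r by (auto simp: add_eq_0_iff power2_eq_iff)
    have plus: "Q + (d / r) *s (A - Q) = Q - (d / - r) *s (A - Q)"
      by (simp add: vec_eq_iff)
    have "eval2 f (Q - (d / r) *s (A - Q)) = 0 \<or> eval2 f (Q + (d / r) *s (A - Q)) = 0"
      using H[OF r0(1) r] H'(2)[OF that(1)] N(1) by auto
    then show ?thesis
    proof
      assume "eval2 f (Q - (d / r) *s (A - Q)) = 0"
      then show ?thesis using r0 r by (intro conchoid_pointsI_inverse[of r]) (auto simp: C)
    next
      assume "eval2 f (Q + (d / r) *s (A - Q)) = 0"
      then show ?thesis unfolding plus
        using r0 r by (intro conchoid_pointsI_inverse[of "- r"]) (auto simp: C)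
    qed
  qed
  define M where "M = {Q. eval2 f (2 *s Q - A) = 0} \<inter> {Q. ?N Q - d\<^sup>2 = 0}"
  have "zariski_closed M"
    unfolding M_def
  proof (intro zariski_closed_Int zariski_closed_zeros)
    show "polynomial_function (\<lambda>Q. eval2 f (2 *s Q - A))"
    proof (rule polynomial_function_eval2)
      show "polynomial_function (\<lambda>Q. (2 *s Q - A) $ i)" for i
        by (simp, intro polynomial_function_diff polynomial_function_mult
            polynomial_function_const polynomial_function_coord')
    qed
    show "polynomial_function (\<lambda>Q. ?N Q - d\<^sup>2)"
      by (intro polynomial_function_diff polynomial_function_norm2_sq polynomial_function_const)
  qed
  then have closed: "zariski_closed ({Q. eval2 H' Q = 0} \<union> {A} \<union> M)"
    by (intro zariski_closed_Un zariski_closed_singleton)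
      (auto intro!: zariski_closed_zeros simp: polynomial_function_def)
  \<comment> \<open>The point that \<open>Q\<close> comes from when \<open>r = d\<close>.\<close>
  have half: "Q - (d / d) *s (A - Q) = 2 *s Q - A" for Q
    using d by (simp add: vec_eq_iff algebra_simps)
  have MB: "M \<subseteq> ?B"
  proof
    fix Q assume "Q \<in> M"
    then have "eval2 f (Q - (d / d) *s (A - Q)) = 0" "d\<^sup>2 = ?N Q"
      unfolding half by (auto simp: M_def)
    then show "Q \<in> ?B" using d by (intro conchoid_pointsI_inverse[of d]) (auto simp: C)
  qed
  have "?B \<subseteq> {Q. eval2 H' Q = 0} \<union> {A} \<union> M"
  proof
    fix Q assume "Q \<in> ?B"
    then consider "Q = A" | r where "r \<noteq> 0" "r + d \<noteq> 0" "r\<^sup>2 = ?N Q" "Q - (d / r) *s (A - Q) \<in> C"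
      using conchoid_points_inverse by blast
    then show "Q \<in> {Q. eval2 H' Q = 0} \<union> {A} \<union> M"
    proof cases
      case 2
      show ?thesis
      proof (cases "eval2 W Q = 0")
        case True
        have "?N Q \<noteq> 0" using 2(1,3) by (metis power_not_zero)
        then have "r\<^sup>2 = d\<^sup>2" using True 2(3) by (simp add: W[symmetric])
        then have "r = d" using 2(2) by (auto simp: power2_eq_iff)
        then have "2 *s Q - A \<in> C" "?N Q - d\<^sup>2 = 0" using 2(3,4) half by simp_all
        then show ?thesis by (simp add: M_def C)
      next
        case False
        have "eval2 H Q = 0" using H[OF 2(1,3)] 2(4) by (simp add: C)
        then show ?thesis using H'(1) False by simp
      qed
    qed simp
  qed
  then have "conchoid C A d \<subseteq> {Q. eval2 H' Q = 0} \<union> {A} \<union> M"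
    unfolding conchoid_eq using closed by (rule zariski_closure_subset)
  then have "conchoid C A d - ?B \<subseteq> {A} \<union> {Q. eval2 H' Q = 0 \<and> eval2 W Q = 0}"
    using MB outside by auto
  then show ?thesis by (rule finite_subset) (simp add: H'(3))
qed


section \<open>Valuation rings\<close>

lemma
  assumes "valuation_subring V"
  shows valuation_subring_1: "1 \<in> V"
    and valuation_subring_0: "0 \<in> V"
    and valuation_subring_diff: "x \<in> V \<Longrightarrow> y \<in> V \<Longrightarrow> x - y \<in> V"
    and valuation_subring_add: "x \<in> V \<Longrightarrow> y \<in> V \<Longrightarrow> x + y \<in> V"
    and valuation_subring_mult: "x \<in> V \<Longrightarrow> y \<in> V \<Longrightarrow> x * y \<in> V"
    and valuation_subring_inverse: "x \<notin> V \<Longrightarrow> inverse x \<in> V"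
proof -
  show 1: "1 \<in> V" and diff: "x \<in> V \<Longrightarrow> y \<in> V \<Longrightarrow> x - y \<in> V"
    and "x \<in> V \<Longrightarrow> y \<in> V \<Longrightarrow> x * y \<in> V" and "x \<notin> V \<Longrightarrow> inverse x \<in> V" for x y
    using assms unfolding valuation_subring_def by blast+
  show 0: "0 \<in> V" using diff[OF 1 1] by simp
  show "x \<in> V \<Longrightarrow> y \<in> V \<Longrightarrow> x + y \<in> V" using diff[OF _ diff[OF 0], of x y] by simp
qed

lemma valuation_ideal_subset: "x \<in> valuation_ideal V \<Longrightarrow> x \<in> V"
  by (simp add: valuation_ideal_def)

lemma not_in_valuation_subring:
  assumes "valuation_subring V" "x \<notin> V"
  shows "x \<noteq> 0" "inverse x \<in> valuation_ideal V"
  using assms valuation_subring_inverse[OF assms] valuation_subring_0[OF assms(1)]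
  by (auto simp: valuation_ideal_def)

lemma valuation_unit:
  assumes "x \<in> V" "x \<notin> valuation_ideal V"
  shows "x \<noteq> 0" "inverse x \<in> V"
  using assms by (auto simp: valuation_ideal_def)

lemma valuation_ideal_mult:
  assumes V: "valuation_subring V" and x: "x \<in> valuation_ideal V" and y: "y \<in> V"
  shows "x * y \<in> valuation_ideal V"
proof -
  have "inverse (x * y) \<notin> V" if "x * y \<noteq> 0"
  proof
    assume "inverse (x * y) \<in> V"
    with y have "y * inverse (x * y) \<in> V" by (intro valuation_subring_mult[OF V])
    moreover have "y * inverse (x * y) = inverse x" using that by (simp add: field_simps)
    ultimately have "inverse x \<in> V" by (simp only:)
    then show False using x that by (simp add: valuation_ideal_def)
  qed
  then show ?thesis
    using x y valuation_subring_mult[OF V] by (auto simp: valuation_ideal_def)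
qed

text \<open>
  Of the two quotients \<open>x / y\<close> and \<open>y / x\<close> one lies in \<open>V\<close>, so the sum is an element of the ideal
  times an element of \<open>V\<close>.
\<close>

lemma valuation_ideal_add:
  assumes V: "valuation_subring V" and xy: "x \<in> valuation_ideal V" "y \<in> valuation_ideal V"
  shows "x + y \<in> valuation_ideal V"
proof -
  have *: "x + y \<in> valuation_ideal V"
    if "x \<in> valuation_ideal V" "y \<noteq> 0" "y / x \<notin> V" "y \<in> valuation_ideal V" for x y
  proof -
    have "x / y \<in> V" using valuation_subring_inverse[OF V that(3)] by simp
    then have "y * (1 + x / y) \<in> valuation_ideal V"
      using that(4) by (intro valuation_ideal_mult[OF V] valuation_subring_add[OF V]
          valuation_subring_1[OF V])
    moreover have "y * (1 + x / y) = x + y" using that(2) by (simp add: field_simps)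
    ultimately show ?thesis by simp
  qed
  show ?thesis
  proof (cases "y / x \<in> V")
    case True
    show ?thesis
    proof (cases "x = 0")
      case False
      have "x * (1 + y / x) \<in> valuation_ideal V"
        using True xy(1) by (intro valuation_ideal_mult[OF V] valuation_subring_add[OF V]
          valuation_subring_1[OF V])
      moreover have "x * (1 + y / x) = x + y" using False by (simp add: field_simps)
      ultimately show ?thesis by simp
    qed (use xy in simp)
  next
    case False
    then show ?thesis using *[OF xy(1) _ False xy(2)] xy(1) by (cases "y = 0") auto
  qed
qed

lemma valuation_ideal_diff:
  assumes V: "valuation_subring V" and "x \<in> valuation_ideal V" "y \<in> valuation_ideal V"
  shows "x - y \<in> valuation_ideal V"
proof -
  have "0 - 1 \<in> V" using V by (intro valuation_subring_diff valuation_subring_0 valuation_subring_1)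
  then have "y * (0 - 1) \<in> valuation_ideal V" using assms by (intro valuation_ideal_mult)
  from valuation_ideal_add[OF V assms(2) this] show ?thesis by simp
qed

lemma valuation_ideal_prime:
  assumes V: "valuation_subring V" and "x \<in> V" "y \<in> V" "x * y \<in> valuation_ideal V"
  shows "x \<in> valuation_ideal V \<or> y \<in> valuation_ideal V"
proof (rule ccontr)
  assume "\<not> ?thesis"
  then have "x \<noteq> 0" "y \<noteq> 0" "inverse x \<in> V" "inverse y \<in> V"
    using assms valuation_unit by blast+
  then have "x * y \<noteq> 0" "inverse (x * y) \<in> V"
    using valuation_subring_mult[OF V] by auto
  then show False using assms(4) by (auto simp: valuation_ideal_def)
qed

lemma one_notin_valuation_ideal: "valuation_subring V \<Longrightarrow> 1 \<notin> valuation_ideal V"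
  using valuation_subring_1[of V] by (simp add: valuation_ideal_def)

lemma valuation_subring_poly:
  assumes V: "valuation_subring V" and "\<And>n. poly.coeff p n \<in> V" "x \<in> V"
  shows "poly p x \<in> V"
  using assms(2)
proof (induction p)
  case 0
  show ?case using valuation_subring_0[OF V] by simp
next
  case (pCons a p)
  have "a \<in> V" using pCons.prems[of 0] by simp
  moreover have "poly.coeff p n \<in> V" for n using pCons.prems[of "Suc n"] by simp
  ultimately show ?case
    using assms(3) pCons.IH
    by (simp add: valuation_subring_add[OF V] valuation_subring_mult[OF V])
qed


section \<open>Values at a place\<close>

definition poly_ac :: "'a::field poly \<Rightarrow> 'a fun_field_ac" where
  "poly_ac p = to_ac (to_fract p)"

lemma poly_ac_simps [simp]:
  "poly_ac 0 = 0" "poly_ac (p + q) = poly_ac p + poly_ac q" "poly_ac (p * q) = poly_ac p * poly_ac q"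
  "poly_ac p = 0 \<longleftrightarrow> p = 0"
  by (simp_all add: poly_ac_def)

lemma const_ac_conv_poly_ac: "const_ac c = poly_ac [:c:]"
  by (simp add: const_ac_def poly_ac_def)

lemma const_ac_0_1 [simp]: "const_ac 0 = 0" "const_ac 1 = 1"
  by (simp_all add: const_ac_def flip: one_pCons)

lemma const_ac_add [simp]: "const_ac (a + b) = const_ac a + const_ac b"
  unfolding const_ac_conv_poly_ac poly_ac_simps(2)[symmetric] by simp

lemma const_ac_mult [simp]: "const_ac (a * b) = const_ac a * const_ac b"
  unfolding const_ac_conv_poly_ac poly_ac_simps(3)[symmetric] by (simp add: mult.commute)

lemma const_ac_diff [simp]: "const_ac (a - b) = const_ac a - const_ac b"
  using const_ac_add[of "a - b" b] by simp

lemma const_ac_minus [simp]: "const_ac (- a) = - const_ac a"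
  using const_ac_diff[of 0 a] by simp

lemma const_ac_eq_0_iff [simp]: "const_ac a = 0 \<longleftrightarrow> a = 0"
  by (simp add: const_ac_conv_poly_ac)

lemma inj_const_ac: "inj const_ac"
proof (rule injI)
  fix a b :: 'a assume "const_ac a = const_ac b"
  then have "const_ac (a - b) = 0" unfolding const_ac_diff by simp
  then show "a = b" unfolding const_ac_eq_0_iff by simp
qed

lemma poly_ac_pCons: "poly_ac (pCons a p) = const_ac a + t_ac * poly_ac p"
proof -
  have "pCons a p = [:a:] + [:0, 1:] * p" by simp
  then show ?thesis
    by (simp only: poly_ac_simps const_ac_conv_poly_ac) (simp add: t_ac_def poly_ac_def)
qed

text \<open>
  A relational form of \<open>place_value\<close>, which makes sense before existence and uniqueness of the
  value are known.
\<close>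

definition has_value :: "'a::field fun_field_ac set \<Rightarrow> 'a fun_field_ac \<Rightarrow> 'a \<Rightarrow> bool" where
  "has_value V S c \<longleftrightarrow> S - const_ac c \<in> valuation_ideal V"

lemma place_atD:
  assumes "place_at t0 V"
  shows "valuation_subring V" "const_ac c \<in> V" "has_value V t_ac t0"
  using assms by (auto simp: place_at_def has_value_def)

lemma has_value_in:
  assumes "place_at t0 V" "has_value V S c"
  shows "S \<in> V"
proof -
  have "S - const_ac c \<in> V"
    using assms(2) unfolding has_value_def by (rule valuation_ideal_subset)
  from valuation_subring_add[OF place_atD(1)[OF assms(1)] this place_atD(2)[OF assms(1)]]
  have "(S - const_ac c) + const_ac c \<in> V" .
  then show ?thesis by simp
qed

lemma has_value_const: "place_at t0 V \<Longrightarrow> has_value V (const_ac c) c"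
  using valuation_subring_0[OF place_atD(1)[of t0 V]] by (simp add: has_value_def valuation_ideal_def)

lemma has_value_add:
  assumes "place_at t0 V" "has_value V S a" "has_value V T b"
  shows "has_value V (S + T) (a + b)"
proof -
  have "(S - const_ac a) + (T - const_ac b) \<in> valuation_ideal V"
    using assms(2,3) unfolding has_value_def
    by (rule valuation_ideal_add[OF place_atD(1)[OF assms(1)]])
  then show ?thesis by (simp add: has_value_def algebra_simps)
qed

lemma has_value_diff:
  assumes "place_at t0 V" "has_value V S a" "has_value V T b"
  shows "has_value V (S - T) (a - b)"
proof -
  have "(S - const_ac a) - (T - const_ac b) \<in> valuation_ideal V"
    using assms(2,3) unfolding has_value_def
    by (rule valuation_ideal_diff[OF place_atD(1)[OF assms(1)]])
  then show ?thesis by (simp add: has_value_def algebra_simps)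
qed

lemma has_value_mult:
  assumes V: "place_at t0 V" and "has_value V S a" "has_value V T b"
  shows "has_value V (S * T) (a * b)"
proof -
  have "(S - const_ac a) * T + (T - const_ac b) * const_ac a \<in> valuation_ideal V"
    using assms(2,3) has_value_in[OF V assms(3)] unfolding has_value_def
    by (intro valuation_ideal_add[OF place_atD(1)[OF V]] valuation_ideal_mult[OF place_atD(1)[OF V]]
        place_atD(2)[OF V])
  then show ?thesis by (simp add: has_value_def algebra_simps)
qed

lemma has_value_0_iff: "has_value V S 0 \<longleftrightarrow> S \<in> valuation_ideal V"
  by (simp add: has_value_def)

lemma has_value_0_unique:
  assumes "place_at t0 V" "has_value V 0 c"
  shows "c = 0"
proof (rule ccontr)
  assume "c \<noteq> 0"
  have "has_value V (0 * const_ac (1 / c)) (c * (1 / c))"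
    using assms by (intro has_value_mult has_value_const)
  then have "has_value V 0 1" using \<open>c \<noteq> 0\<close> by simp
  then have "has_value V (const_ac 1 - 0) (1 - 1)"
    by (intro has_value_diff[OF assms(1)] has_value_const[OF assms(1)])
  then show False
    using one_notin_valuation_ideal[OF place_atD(1)[OF assms(1)]] by (simp add: has_value_0_iff)
qed

lemma has_value_unique:
  assumes "place_at t0 V" "has_value V S a" "has_value V S b"
  shows "a = b"
  using has_value_0_unique[OF assms(1), of "a - b"] has_value_diff[OF assms] by simp

lemma has_value_poly_ac:
  assumes V: "place_at t0 V"
  shows "has_value V (poly_ac p) (poly p t0)"
proof (induction p)
  case 0
  show ?case using has_value_const[OF V, of 0] by simp
next
  case (pCons a p)
  then show ?case
    unfolding poly_ac_pCons poly_pCons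
    by (intro has_value_add[OF V] has_value_mult[OF V] has_value_const[OF V] place_atD(3)[OF V])
qed

lemma common_denominator:
  fixes p :: "'b::idom fract poly"
  shows "\<exists>c q. c \<noteq> 0 \<and> Polynomial.smult (to_fract c) p = map_poly to_fract q"
proof (induction p)
  case 0
  show ?case by (rule exI[of _ 1], rule exI[of _ 0]) simp
next
  case (pCons a p)
  then obtain c q where cq: "c \<noteq> 0" "Polynomial.smult (to_fract c) p = map_poly to_fract q" by blast
  obtain u v where uv: "a = to_fract u / to_fract v" "v \<noteq> 0"
    by (cases a) (auto simp: Fract_conv_to_fract)
  have "Polynomial.smult (to_fract (v * c)) (pCons a p) =
      map_poly to_fract (pCons (u * c) (Polynomial.smult v q))"
    using uv by (simp add: map_poly_pCons flip: cq(2))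
  with cq uv show ?case
    by (intro exI[of _ "v * c"] exI[of _ "pCons (u * c) (Polynomial.smult v q)"]) simp
qed

lemma poly_map_smult:
  assumes "h 0 = 0" "\<And>a b. h (a * b) = h a * h b"
  shows "poly (map_poly h (Polynomial.smult c p)) x = h c * poly (map_poly h p) x"
  by (induction p) (simp_all add: assms map_poly_pCons algebra_simps)

text \<open>
  Clearing denominators in an equation over \<open>F(t)\<close> gives one over \<open>F[t]\<close>.
\<close>

lemma algebraic_over_polynomials:
  fixes S :: "'a::field fun_field_ac"
  obtains q where "q \<noteq> 0" "poly (map_poly poly_ac q) S = 0"
proof -
  obtain p :: "'a fun_field poly" where p: "p \<noteq> 0" "poly (map_poly to_ac p) S = 0"
    by (rule alg_closure_algebraic)
  obtain c q where cq: "c \<noteq> 0" "Polynomial.smult (to_fract c) p = map_poly to_fract q"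
    using common_denominator by blast
  have "map_poly poly_ac q = map_poly to_ac (map_poly to_fract q)"
    by (simp add: map_poly_map_poly comp_def poly_ac_def[abs_def])
  also have "\<dots> = map_poly to_ac (Polynomial.smult (to_fract c) p)"
    by (simp only: cq(2))
  finally have "poly (map_poly poly_ac q) S = 0"
    by (simp add: poly_map_smult p(2))
  moreover have "q \<noteq> 0" using cq p(1) by auto
  ultimately show ?thesis using that by blast
qed


lemma lead_coeff_map_poly_ac:
  "Polynomial.lead_coeff (map_poly poly_ac q) = poly_ac (Polynomial.lead_coeff q)"
  by (cases "q = 0") (simp_all add: degree_map_poly coeff_map_poly)

text \<open>
  Outside the zeros of the leading coefficient \<open>S\<close> is integral over the valuation ring, hence in it:
  otherwise \<open>inverse S\<close> would lie in the maximal ideal, and the reversed equation would put the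
  leading coefficient there as well.
\<close>

lemma in_place_if_lead_coeff:
  assumes V: "place_at t0 V" and q: "poly (map_poly poly_ac q) S = 0"
    and lc: "poly (Polynomial.lead_coeff q) t0 \<noteq> 0"
  shows "S \<in> V"
proof (rule ccontr)
  assume S: "S \<notin> V"
  note VR = place_atD(1)[OF V]
  note S0 = not_in_valuation_subring[OF VR S]
  let ?p = "map_poly poly_ac q" and ?y = "inverse S"
  obtain a p' where r: "reflect_poly ?p = pCons a p'" by (cases "reflect_poly ?p")
  have a: "a = poly_ac (Polynomial.lead_coeff q)"
    using coeff_0_reflect_poly[of ?p] by (simp add: r lead_coeff_map_poly_ac)
  have "poly (reflect_poly ?p) ?y = 0"
    using S0(1) q by (simp add: poly_reflect_poly_nz)
  then have "a = - (?y * poly p' ?y)" by (simp add: r eq_neg_iff_add_eq_0)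
  moreover have "poly p' ?y \<in> V"
  proof (rule valuation_subring_poly[OF VR])
    have "poly.coeff p' n = poly.coeff (reflect_poly ?p) (Suc n)" for n by (simp add: r)
    moreover have "poly.coeff ?p n \<in> V" for n
      using has_value_in[OF V has_value_poly_ac[OF V]] by (simp add: coeff_map_poly)
    ultimately show "poly.coeff p' n \<in> V" for n
      using valuation_subring_0[OF VR] by (simp add: coeff_reflect_poly)
    show "?y \<in> V" by (rule valuation_ideal_subset[OF S0(2)])
  qed
  ultimately have "0 - a \<in> valuation_ideal V"
    using valuation_ideal_mult[OF VR S0(2)] by simp
  then have "has_value V (0 - a) 0" by (simp add: has_value_0_iff)
  moreover have "has_value V (0 - a) (0 - poly (Polynomial.lead_coeff q) t0)"
    unfolding a using has_value_const[OF V, of 0] has_value_poly_ac[OF V]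
    by (intro has_value_diff[OF V]) simp_all
  ultimately show False using has_value_unique[OF V] lc by fastforce
qed

lemma finite_not_in_place:
  assumes V: "\<And>t0. place_at t0 (V t0)"
  shows "finite {t0. S \<notin> V t0}"
proof -
  obtain q where q: "q \<noteq> 0" "poly (map_poly poly_ac q) S = 0"
    by (rule algebraic_over_polynomials)
  then have "{t0. S \<notin> V t0} \<subseteq> {t0. poly (Polynomial.lead_coeff q) t0 = 0}"
    using in_place_if_lead_coeff[OF V] by blast
  moreover have "finite {t0. poly (Polynomial.lead_coeff q) t0 = 0}"
    using q(1) by (intro poly_roots_finite) simp
  ultimately show ?thesis by (rule finite_subset)
qed

text \<open>
  If \<open>S \<noteq> 0\<close>, its inverse is defined almost everywhere, and where it is, \<open>S\<close> does not have value 0.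
\<close>

lemma eq_0_if_value_0:
  fixes V :: "'a::field_char_0 \<Rightarrow> 'a fun_field_ac set"
  assumes V: "\<And>t0. place_at t0 (V t0)"
    and fin: "finite {t0. \<not> has_value (V t0) S 0}"
  shows "S = 0"
proof (rule ccontr)
  assume "S \<noteq> 0"
  have "UNIV \<subseteq> {t0. \<not> has_value (V t0) S 0} \<union> {t0. inverse S \<notin> V t0}"
    using \<open>S \<noteq> 0\<close> by (auto simp: has_value_0_iff valuation_ideal_def)
  then show False
    using fin finite_not_in_place[OF V] infinite_UNIV_char_0 finite_subset by blast
qed

lemma has_value_poly_const:
  assumes V: "place_at t0 V" and S: "has_value V S c"
  shows "has_value V (poly (map_poly const_ac p) S) (poly p c)"
proof (induction p)
  case 0
  show ?case using has_value_const[OF V, of 0] by simp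
next
  case (pCons a p)
  then show ?case
    by (simp add: map_poly_pCons)
      (intro has_value_add[OF V] has_value_mult[OF V] has_value_const[OF V] S)
qed

lemma poly_specialize_congruent:
  assumes V: "place_at t0 V" and S: "S \<in> V"
  shows "poly (map_poly poly_ac q) S - poly (map_poly const_ac (specialize q t0)) S
    \<in> valuation_ideal V"
proof (induction q)
  case 0
  show ?case using has_value_const[OF V, of 0] by (simp add: specialize_def has_value_0_iff)
next
  case (pCons a q)
  have "poly_ac a - const_ac (poly a t0) \<in> valuation_ideal V"
    using has_value_poly_ac[OF V] by (simp add: has_value_def)
  then have "(poly_ac a - const_ac (poly a t0)) +
     (poly (map_poly poly_ac q) S - poly (map_poly const_ac (specialize q t0)) S) * S
     \<in> valuation_ideal V"
    by (intro valuation_ideal_add valuation_ideal_mult place_atD(1)[OF V] pCons.IH S)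
  then show ?case
    by (simp add: specialize_def map_poly_pCons algebra_simps)
qed

text \<open>
  If all coefficients of an equation vanish at \<open>t0\<close>, then \<open>t - t0\<close> can be divided out; this lowers the
  degree in \<open>t\<close> of the leading coefficient, so the process ends.
\<close>

lemma algebraic_primitive:
  obtains q where "poly (map_poly poly_ac q) S = 0" "specialize q t0 \<noteq> 0"
proof -
  let ?P = "\<lambda>q. q \<noteq> 0 \<and> poly (map_poly poly_ac q) S = 0"
  obtain q0 where "?P q0" using algebraic_over_polynomials by blast
  then obtain q where q: "?P q"
    and min: "\<And>p. ?P p \<Longrightarrow> Polynomial.degree (Polynomial.lead_coeff q) \<le> Polynomial.degree (Polynomial.lead_coeff p)"
    using ex_has_least_nat[of ?P q0 "\<lambda>q. Polynomial.degree (Polynomial.lead_coeff q)"] by blast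
  have "specialize q t0 \<noteq> 0"
  proof
    assume "specialize q t0 = 0"
    then obtain p where p: "q = [:[:-t0, 1:]:] * p"
      unfolding specialize_eq_0_iff by (elim dvdE)
    then have q': "q = Polynomial.smult [:-t0, 1:] p" by simp
    have "p \<noteq> 0" using q p by auto
    then have "Polynomial.degree (Polynomial.lead_coeff q) =
        Suc (Polynomial.degree (Polynomial.lead_coeff p))"
      unfolding q' lead_coeff_smult by (subst degree_mult_eq) auto
    moreover have "poly_ac [:-t0, 1:] * poly (map_poly poly_ac p) S = 0"
      using q unfolding q' by (subst poly_map_smult[symmetric]) auto
    then have "?P p" using \<open>p \<noteq> 0\<close> by simp
    ultimately show False using min by fastforce
  qed
  with q show ?thesis using that by blast
qed

text \<open>
  The residue field is \<open>F\<close>: reducing the coefficients of a primitive equation of \<open>S\<close> at \<open>t0\<close> gives a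
  nonzero polynomial \<open>p\<close> over \<open>F\<close> with \<open>p(S)\<close> in the maximal ideal. Over the algebraically closed
  field \<open>F\<close> it splits into linear factors, and one of them lies in the ideal, which is prime.
\<close>

lemma has_value_exists:
  fixes S :: "'a::alg_closed_field fun_field_ac"
  assumes V: "place_at t0 V" and S: "S \<in> V"
  shows "\<exists>c. has_value V S c"
proof -
  note VR = place_atD(1)[OF V]
  have root: "\<exists>c. has_value V S c"
    if "p \<noteq> 0" "poly (map_poly const_ac p) S \<in> valuation_ideal V" for p
    using that
  proof (induction "Polynomial.degree p" arbitrary: p)
    case 0
    then obtain k where k: "p = [:k:]" by (metis degree_eq_zeroE)
    with 0 have "has_value V (const_ac k) 0" by (simp add: map_poly_pCons has_value_0_iff)
    then have "k = 0" using has_value_unique[OF V has_value_const[OF V]] by blast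
    with 0 k show ?case by simp
  next
    case (Suc n)
    obtain c where "poly p c = 0"
      using alg_closed_imp_poly_has_root[of p] Suc.hyps(2) by auto
    then obtain p' where p: "p = [:-c, 1:] * p'" by (auto simp: poly_eq_0_iff_dvd)
    have p'0: "p' \<noteq> 0" using Suc.prems p by auto
    have "Polynomial.degree p = Polynomial.degree [:-c, 1:] + Polynomial.degree p'"
      unfolding p using p'0 by (intro degree_mult_eq) auto
    then have deg: "n = Polynomial.degree p'" using Suc.hyps(2) by simp
    have add: "poly (map_poly const_ac (a + b)) S =
        poly (map_poly const_ac a) S + poly (map_poly const_ac b) S" for a b
      by (induction a b rule: poly_induct2) (simp_all add: map_poly_pCons algebra_simps)
    have p_sum: "p = pCons 0 p' + Polynomial.smult (0 - c) p'" unfolding p by simp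
    have "poly (map_poly const_ac p) S = (S - const_ac c) * poly (map_poly const_ac p') S"
      unfolding p_sum add poly_map_smult[OF const_ac_0_1(1) const_ac_mult]
      by (simp add: map_poly_pCons algebra_simps)
    moreover have "S - const_ac c \<in> V"
      by (intro valuation_subring_diff[OF VR] S place_atD(2)[OF V])
    moreover have "poly (map_poly const_ac p') S \<in> V"
      by (intro valuation_subring_poly[OF VR] S) (simp add: coeff_map_poly place_atD(2)[OF V])
    ultimately have "S - const_ac c \<in> valuation_ideal V \<or>
        poly (map_poly const_ac p') S \<in> valuation_ideal V"
      using Suc.prems(2) valuation_ideal_prime[OF VR] by metis
    then show ?case
      using Suc.hyps(1)[OF deg p'0] by (auto simp: has_value_def)
  qed
  obtain q where q: "poly (map_poly poly_ac q) S = 0" "specialize q t0 \<noteq> 0"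
    by (rule algebraic_primitive)
  have "0 - poly (map_poly const_ac (specialize q t0)) S \<in> valuation_ideal V"
    using poly_specialize_congruent[OF V S, of q] q(1) by simp
  from valuation_ideal_diff[OF VR _ this, of 0] have
    "poly (map_poly const_ac (specialize q t0)) S \<in> valuation_ideal V"
    using has_value_const[OF V, of 0] by (simp add: has_value_0_iff)
  with root q(2) show ?thesis by blast
qed

lemma place_value_eq:
  assumes "place_at t0 V" "has_value V S c"
  shows "place_value V S = c"
  unfolding place_value_def
  using assms has_value_unique[OF assms(1)] by (auto simp: has_value_def intro: the_equality)

definition has_values :: "'a::field fun_field_ac set \<Rightarrow> 'a fun_field_ac ^ 2 \<Rightarrow> 'a ^ 2 \<Rightarrow> bool" where
  "has_values V R P \<longleftrightarrow> (\<forall>i. has_value V (R $ i) (P $ i))"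

lemma has_values_eval_at:
  fixes R :: "'a::alg_closed_field fun_field_ac ^ 2"
  assumes V: "place_at t0 V" and "defined_at V R"
  shows "has_values V R (eval_at V R)"
  unfolding has_values_def
proof
  fix i
  obtain c where "has_value V (R $ i) c"
    using has_value_exists[OF V] assms(2) unfolding defined_at_def by blast
  with place_value_eq[OF V this] show "has_value V (R $ i) (eval_at V R $ i)"
    by (simp add: eval_at_def)
qed

lemma has_values_defined_at: "place_at t0 V \<Longrightarrow> has_values V R P \<Longrightarrow> defined_at V R"
  unfolding has_values_def defined_at_def using has_value_in by blast

lemma has_values_imp_eval_at:
  "place_at t0 V \<Longrightarrow> has_values V R P \<Longrightarrow> eval_at V R = P"
  unfolding has_values_def eval_at_def using place_value_eq by (simp add: vec_eq_iff) blast

abbreviation lift_poly :: "'a::field poly poly \<Rightarrow> 'a fun_field_ac poly poly" where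
  "lift_poly f \<equiv> map_poly (map_poly const_ac) f"

lemma has_value_eval2:
  assumes V: "place_at t0 V" and R: "has_values V R P"
  shows "has_value V (eval2 (lift_poly f) R) (eval2 f P)"
proof (induction f)
  case 0
  show ?case using has_value_const[OF V, of 0] by simp
next
  case (pCons a f)
  then show ?case
    using R unfolding has_values_def
    by (simp add: map_poly_pCons eval2_pCons)
      (intro has_value_add[OF V] has_value_mult[OF V] has_value_poly_const[OF V], auto)
qed

lemma finite_undefined:
  fixes R :: "'a::field fun_field_ac ^ 2"
  assumes V: "\<And>t0. place_at t0 (V t0)"
  shows "finite {t0. \<not> defined_at (V t0) R}"
proof -
  have "{t0. \<not> defined_at (V t0) R} = (\<Union>i. {t0. R $ i \<notin> V t0})"
    by (auto simp: defined_at_def)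
  then show ?thesis using finite_not_in_place[OF V] by simp
qed

text \<open>
  An algebraic relation that holds at almost all parameters holds identically, hence at every
  parameter where \<open>R\<close> is defined.
\<close>

lemma eval_at_in_zero_set:
  fixes R :: "'a::{alg_closed_field, field_char_0} fun_field_ac ^ 2"
  assumes V: "\<And>t0. place_at t0 (V t0)"
    and fin: "finite {t0. defined_at (V t0) R \<and> eval2 f (eval_at (V t0) R) \<noteq> 0}"
    and t0: "defined_at (V t0) R"
  shows "eval2 f (eval_at (V t0) R) = 0"
proof -
  have val: "has_value (V s) (eval2 (lift_poly f) R) (eval2 f (eval_at (V s) R))"
    if "defined_at (V s) R" for s
    using that by (intro has_value_eval2[OF V] has_values_eval_at[OF V])
  have "{s. \<not> has_value (V s) (eval2 (lift_poly f) R) 0} \<subseteq>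
      {s. \<not> defined_at (V s) R} \<union> {s. defined_at (V s) R \<and> eval2 f (eval_at (V s) R) \<noteq> 0}"
  proof (intro subsetI, elim CollectE)
    fix s assume "\<not> has_value (V s) (eval2 (lift_poly f) R) 0"
    then show "s \<in> {s. \<not> defined_at (V s) R} \<union>
        {s. defined_at (V s) R \<and> eval2 f (eval_at (V s) R) \<noteq> 0}"
      using val[of s] by fastforce
  qed
  then have "finite {s. \<not> has_value (V s) (eval2 (lift_poly f) R) 0}"
    using fin finite_undefined[OF V] by (meson finite_UnI finite_subset)
  then have "eval2 (lift_poly f) R = 0" by (rule eq_0_if_value_0[OF V])
  with val[OF t0] show ?thesis using has_value_0_unique[OF V] by simp
qed


section \<open>Adjoining a square root to a root tower\<close>

lemma
  assumes "is_subfield L"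
  shows subfield_diff: "x \<in> L \<Longrightarrow> y \<in> L \<Longrightarrow> x - y \<in> L"
    and subfield_add: "x \<in> L \<Longrightarrow> y \<in> L \<Longrightarrow> x + y \<in> L"
    and subfield_mult: "x \<in> L \<Longrightarrow> y \<in> L \<Longrightarrow> x * y \<in> L"
    and subfield_divide: "x \<in> L \<Longrightarrow> y \<in> L \<Longrightarrow> x / y \<in> L"
proof -
  have 1: "1 \<in> L" using assms unfolding is_subfield_def by blast
  show diff: "x \<in> L \<Longrightarrow> y \<in> L \<Longrightarrow> x - y \<in> L"
    and mult: "x \<in> L \<Longrightarrow> y \<in> L \<Longrightarrow> x * y \<in> L" for x y
    using assms unfolding is_subfield_def by blast+
  have 0: "0 \<in> L" using diff[OF 1 1] by simp
  show "x \<in> L \<Longrightarrow> y \<in> L \<Longrightarrow> x + y \<in> L" using diff[OF _ diff[OF 0], of x y] by simp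
  show "x / y \<in> L" if "x \<in> L" "y \<in> L"
    using mult[OF that(1), of "inverse y"] that(2) assms
    by (simp add: divide_inverse is_subfield_def)
qed

lemma is_subfield_base_field: "is_subfield base_field"
  unfolding is_subfield_def base_field_def
proof (intro conjI ballI)
  show "1 \<in> range to_ac" by (rule range_eqI[of _ _ 1]) simp
  fix x y :: "'a fun_field_ac" assume "x \<in> range to_ac" "y \<in> range to_ac"
  then obtain a b where "x = to_ac a" "y = to_ac b" by blast
  then show "x - y \<in> range to_ac" "x * y \<in> range to_ac" "inverse x \<in> range to_ac"
    by (simp_all flip: to_ac_diff to_ac_mult to_ac_inverse)
qed

lemma is_subfield_splitting_field: "is_subfield (splitting_field L p)"
  unfolding splitting_field_def by (rule hull_in) (auto simp: is_subfield_def)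

lemma splitting_field_superset: "L \<subseteq> splitting_field L p"
  unfolding splitting_field_def by (meson hull_subset le_supE)

lemma splitting_field_root: "poly p x = 0 \<Longrightarrow> x \<in> splitting_field L p"
  unfolding splitting_field_def by (rule hull_inc) simp

definition radical_extension :: "'a::field fun_field_ac set \<Rightarrow> bool" where
  "radical_extension E \<longleftrightarrow> (\<exists>g Ks. root_tower g Ks \<and> E = last Ks)"

lemma square_parametrization_iff:
  "square_parametrization R \<longleftrightarrow>
     (\<exists>E. radical_extension E \<and> (\<forall>i. R $ i \<in> E)) \<and> \<not> (\<forall>i. R $ i \<in> range const_ac)"
  unfolding square_parametrization_def radical_extension_def soluble_by_radicals_def by blast

lemma radical_extension_subfield:
  assumes "radical_extension E"
  shows "is_subfield E" "base_field \<subseteq> E"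
proof -
  obtain g Ks where Ks: "root_tower g Ks" "E = last Ks"
    using assms unfolding radical_extension_def by blast
  have "is_subfield (Ks ! i) \<and> base_field \<subseteq> Ks ! i" if "i < length Ks" for i
    using that
  proof (induction i)
    case 0
    have "Ks ! 0 = base_field"
      using Ks(1) by (simp add: root_tower_def flip: hd_conv_nth)
    then show ?case by (simp add: is_subfield_base_field)
  next
    case (Suc i)
    then obtain p where "Ks ! Suc i = splitting_field (Ks ! i) p"
      using Ks(1) unfolding root_tower_def by blast
    then show ?case
      using Suc splitting_field_superset[of "Ks ! i" p] is_subfield_splitting_field by auto
  qed
  moreover have "Ks \<noteq> []" using Ks(1) by (simp add: root_tower_def)
  ultimately show "is_subfield E" "base_field \<subseteq> E"
    unfolding Ks(2) by (simp_all add: last_conv_nth)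
qed

text \<open>
  The tower that ends in \<open>E\<close> is extended by the splitting field of \<open>x\<^sup>2 - N\<close>.
\<close>

lemma radical_extension_sqrt:
  assumes "radical_extension E" "N \<in> E" "S\<^sup>2 = N" "S \<noteq> 0"
  obtains E' where "radical_extension E'" "E \<subseteq> E'" "S \<in> E'"
proof -
  obtain g Ks where Ks: "root_tower g Ks" "E = last Ks"
    using assms unfolding radical_extension_def by blast
  define p where "p = Polynomial.monom 1 2 - [:N:]"
  define E' where "E' = splitting_field E p"
  have sub: "E \<subseteq> E'" unfolding E'_def by (rule splitting_field_superset)
  have Ks0: "Ks \<noteq> []" using Ks(1) by (simp add: root_tower_def)
  have step: "\<exists>l a. l > 0 \<and> a \<in> (Ks @ [E']) ! i \<and> a \<noteq> 0 \<and>
      (Ks @ [E']) ! Suc i = splitting_field ((Ks @ [E']) ! i) (Polynomial.monom 1 l - [:a:])"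
    if "Suc i < length (Ks @ [E'])" for i
  proof (cases "Suc i < length Ks")
    case True
    then show ?thesis using Ks(1) unfolding root_tower_def by (simp add: nth_append)
  next
    case False
    then have i: "i = length Ks - 1" "Suc i = length Ks" "i < length Ks" using that by auto
    have "Ks ! i = E" unfolding Ks(2) i(1) using Ks0 by (simp add: last_conv_nth)
    then have "(Ks @ [E']) ! i = E" "(Ks @ [E']) ! Suc i = E'"
      using i(2,3) by (simp_all add: nth_append)
    moreover have "N \<noteq> 0" using assms(3,4) by auto
    ultimately show ?thesis
      using assms(2) by (intro exI[of _ 2] exI[of _ N]) (simp add: E'_def p_def)
  qed
  have "root_tower g (Ks @ [E'])"
    using Ks step sub unfolding root_tower_def by auto
  then have "radical_extension E'" unfolding radical_extension_def by force
  moreover have "S \<in> E'"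
    unfolding E'_def by (rule splitting_field_root) (simp add: p_def poly_monom assms(3))
  ultimately show ?thesis using sub that by blast
qed


section \<open>Parametrizing the conchoid\<close>

definition const_vec :: "'a::field ^ 2 \<Rightarrow> 'a fun_field_ac ^ 2" where
  "const_vec P = (\<chi> i. const_ac (P $ i))"

lemma const_vec_component [simp]: "const_vec P $ i = const_ac (P $ i)"
  by (simp add: const_vec_def)

lemma inj_const_vec: "inj const_vec"
  using inj_const_ac by (auto simp: inj_def vec_eq_iff)

lemma finite_conchoid_points:
  fixes C :: "('b::field ^ 2) set"
  assumes "finite C"
  shows "finite (conchoid_points C A d)"
proof -
  have "finite {s. s\<^sup>2 = c}" for c :: 'b
  proof (cases "\<exists>s. s\<^sup>2 = c")
    case True
    then obtain s where "s\<^sup>2 = c" ..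
    then have "{s. s\<^sup>2 = c} \<subseteq> {s, - s}" by (auto simp: power2_eq_iff)
    then show ?thesis by (rule finite_subset) simp
  qed simp
  moreover have "conchoid_points C A d \<subseteq>
      (\<Union>P\<in>C. (\<lambda>s. P + (d / s) *s (A - P)) ` {s. s\<^sup>2 = norm2_sq (A - P)})"
    unfolding conchoid_points_def by blast
  ultimately show ?thesis using assms by (auto intro: finite_subset)
qed

text \<open>
  The conchoid construction uses field operations and a single square root, namely \<open>S\<close>.
\<close>

lemma square_parametrization_conchoid_point:
  assumes R: "square_parametrization R"
    and S: "S\<^sup>2 = norm2_sq (const_vec A - R)" "S \<noteq> 0"
    and nonconst: "R + (const_ac d / S) *s (const_vec A - R) \<notin> range const_vec"
  shows "square_parametrization (R + (const_ac d / S) *s (const_vec A - R))"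
proof -
  obtain E where E: "radical_extension E" "\<And>i. R $ i \<in> E"
    using R unfolding square_parametrization_iff by blast
  have const: "const_ac c \<in> E" for c
    using radical_extension_subfield(2)[OF E(1)] by (auto simp: base_field_def const_ac_def)
  note subE = radical_extension_subfield(1)[OF E(1)]
  have "norm2_sq (const_vec A - R) \<in> E"
    unfolding norm2_sq_def power2_eq_square vector_minus_component const_vec_component
    by (intro subfield_add[OF subE] subfield_mult[OF subE] subfield_diff[OF subE] const E(2))
  then obtain E' where E': "radical_extension E'" "E \<subseteq> E'" "S \<in> E'"
    using radical_extension_sqrt[OF E(1) _ S] by blast
  note subE' = radical_extension_subfield(1)[OF E'(1)]
  have "(R + (const_ac d / S) *s (const_vec A - R)) $ i \<in> E'" for i
    unfolding vector_add_component vector_smult_component vector_minus_component const_vec_component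
    by (intro subfield_add[OF subE'] subfield_mult[OF subE'] subfield_diff[OF subE']
        subfield_divide[OF subE'] subsetD[OF E'(2)] const E(2) E'(3))
  moreover have "\<not> (\<forall>i. (R + (const_ac d / S) *s (const_vec A - R)) $ i \<in> range const_ac)"
  proof
    assume "\<forall>i. (R + (const_ac d / S) *s (const_vec A - R)) $ i \<in> range const_ac"
    then have "\<forall>i. \<exists>c. (R + (const_ac d / S) *s (const_vec A - R)) $ i = const_ac c" by blast
    then obtain c where c: "\<forall>i. (R + (const_ac d / S) *s (const_vec A - R)) $ i = const_ac (c i)"
      by (rule choice[THEN exE])
    have "R + (const_ac d / S) *s (const_vec A - R) = const_vec (\<chi> i. c i)"
      unfolding vec_eq_iff const_vec_component using c by simp
    with nonconst show False by blast
  qed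
  ultimately show ?thesis using E'(1) unfolding square_parametrization_iff by blast
qed

text \<open>
  Valuation rings are integrally closed; if \<open>S\<close> were outside \<open>V\<close>, then \<open>S = S\<^sup>2 * inverse S\<close> would be
  in \<open>V\<close>.
\<close>

lemma in_place_if_square_has_value:
  assumes V: "place_at t0 V" and N: "has_value V (S\<^sup>2) n"
  shows "S \<in> V"
proof (rule ccontr)
  assume S: "S \<notin> V"
  note VR = place_atD(1)[OF V]
  have "inverse S \<in> V" by (rule valuation_subring_inverse[OF VR S])
  then have "S\<^sup>2 * inverse S \<in> V"
    by (intro valuation_subring_mult[OF VR] has_value_in[OF V N])
  moreover have "S\<^sup>2 * inverse S = S"
    using not_in_valuation_subring(1)[OF VR S] by (simp add: power2_eq_square)
  ultimately show False using S by simp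
qed

lemma has_value_inverse:
  assumes V: "place_at t0 V" and S: "has_value V S s" and s: "s \<noteq> 0"
  shows "has_value V (inverse S) (inverse s)"
proof -
  note VR = place_atD(1)[OF V]
  have "S \<notin> valuation_ideal V"
    using has_value_unique[OF V S] s unfolding has_value_0_iff[symmetric] by blast
  from valuation_unit[OF has_value_in[OF V S] this] have S0: "S \<noteq> 0" "inverse S \<in> V" by auto
  have "const_ac s * const_ac (inverse s) = 1" using s by (simp flip: const_ac_mult)
  then have "inverse S - const_ac (inverse s) = (S - const_ac s) * ((0 - const_ac (inverse s)) * inverse S)"
    using S0(1) by (simp add: field_simps)
  moreover have "\<dots> \<in> valuation_ideal V"
    using S unfolding has_value_def
    by (intro valuation_ideal_mult[OF VR] valuation_subring_mult[OF VR] valuation_subring_diff[OF VR]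
        valuation_subring_0[OF VR] place_atD(2)[OF V] S0(2))
  ultimately show ?thesis by (simp add: has_value_def)
qed

lemma has_value_norm2_sq:
  assumes V: "place_at t0 V" and R: "has_values V R P"
  shows "has_value V (norm2_sq (const_vec A - R)) (norm2_sq (A - P))"
  using R unfolding norm2_sq_def power2_eq_square vector_minus_component const_vec_component
  by (intro has_value_add[OF V] has_value_mult[OF V] has_value_diff[OF V] has_value_const[OF V])
    (simp_all add: has_values_def)

lemma has_values_conchoid_point:
  assumes V: "place_at t0 V" and R: "has_values V R P" and S: "has_value V S s" "s \<noteq> 0"
  shows "has_values V (R + (const_ac d / S) *s (const_vec A - R)) (P + (d / s) *s (A - P))"
  using R unfolding has_values_def divide_inverse
    vector_add_component vector_smult_component vector_minus_component const_vec_component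
  by (intro allI has_value_add[OF V] has_value_mult[OF V] has_value_diff[OF V] has_value_const[OF V]
      has_value_inverse[OF V] S) auto

text \<open>
  At almost all parameters \<open>R\<close>, \<open>S\<close> and \<open>inverse S\<close> are defined, and there \<open>R'\<close> evaluates to a swept
  point. At the remaining parameters \<open>R'\<close> can be defined although \<open>R\<close> or \<open>inverse S\<close> is not; its value
  then satisfies all equations of the swept points, so it lies in their closure.
\<close>

lemma eval_at_conchoid_point_in_conchoid:
  fixes V :: "'a::{alg_closed_field, field_char_0} \<Rightarrow> 'a fun_field_ac set"
  assumes V: "\<And>t0. place_at t0 (V t0)"
    and R: "\<And>t0. defined_at (V t0) R \<Longrightarrow> eval_at (V t0) R \<in> C"
    and S: "S\<^sup>2 = norm2_sq (const_vec A - R)" "S \<noteq> 0"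
    and R': "R' = R + (const_ac d / S) *s (const_vec A - R)"
    and t0: "defined_at (V t0) R'"
  shows "eval_at (V t0) R' \<in> conchoid C A d"
  unfolding conchoid_eq
proof (rule in_zariski_closureI)
  fix f assume f: "\<And>Q. Q \<in> conchoid_points C A d \<Longrightarrow> eval2 f Q = 0"
  have good: "eval_at (V s) R' \<in> conchoid_points C A d"
    if s: "defined_at (V s) R" "S \<in> V s" "inverse S \<in> V s" for s
  proof -
    obtain v where v: "has_value (V s) S v" using has_value_exists[OF V s(2)] by blast
    have "v \<noteq> 0"
    proof
      assume "v = 0"
      with v S(2) s(3) show False by (simp add: has_value_0_iff valuation_ideal_def)
    qed
    have RP: "has_values (V s) R (eval_at (V s) R)" by (rule has_values_eval_at[OF V s(1)])
    have "has_value (V s) (S\<^sup>2) (v\<^sup>2)"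
      unfolding power2_eq_square by (rule has_value_mult[OF V v v])
    then have "v\<^sup>2 = norm2_sq (A - eval_at (V s) R)"
      using has_value_norm2_sq[OF V RP] has_value_unique[OF V] unfolding S(1) by blast
    moreover have "eval_at (V s) R' = eval_at (V s) R + (d / v) *s (A - eval_at (V s) R)"
      unfolding R' by (rule has_values_imp_eval_at[OF V
          has_values_conchoid_point[OF V RP v \<open>v \<noteq> 0\<close>]])
    ultimately show ?thesis using R[OF s(1)] \<open>v \<noteq> 0\<close> by (simp add: conchoid_pointsI)
  qed
  have "{s. defined_at (V s) R' \<and> eval2 f (eval_at (V s) R') \<noteq> 0} \<subseteq>
      {s. \<not> defined_at (V s) R} \<union> {s. S \<notin> V s} \<union> {s. inverse S \<notin> V s}"
    using f good by blast
  then have "finite {s. defined_at (V s) R' \<and> eval2 f (eval_at (V s) R') \<noteq> 0}"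
    by (rule finite_subset) (simp add: finite_undefined[OF V] finite_not_in_place[OF V])
  then show "eval2 f (eval_at (V t0) R') = 0"
    by (rule eval_at_in_zero_set[OF V _ t0])
qed

text \<open>
  A square root \<open>S\<close> of the squared distance of \<open>R\<close> to \<open>A\<close> is defined wherever \<open>R\<close> is, and its value is
  \<open>s\<close> or \<open>- s\<close>; after a change of sign it is \<open>s\<close>.
\<close>

lemma conchoid_point_is_value:
  fixes R :: "'a::alg_closed_field fun_field_ac ^ 2"
  assumes V: "place_at t0 V" and R: "has_values V R P"
    and s: "s\<^sup>2 = norm2_sq (A - P)" "s \<noteq> 0"
  obtains S where "S\<^sup>2 = norm2_sq (const_vec A - R)" "S \<noteq> 0"
    "has_values V (R + (const_ac d / S) *s (const_vec A - R)) (P + (d / s) *s (A - P))"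
proof -
  obtain T where T: "T\<^sup>2 = norm2_sq (const_vec A - R)"
    using nth_root_exists[of 2 "norm2_sq (const_vec A - R)"] by auto
  have T2: "has_value V (T\<^sup>2) (s\<^sup>2)"
    unfolding T s(1) by (rule has_value_norm2_sq[OF V R])
  then obtain v where v: "has_value V T v"
    using has_value_exists[OF V in_place_if_square_has_value[OF V]] by blast
  have "has_value V (T\<^sup>2) (v\<^sup>2)"
    unfolding power2_eq_square by (rule has_value_mult[OF V v v])
  then have "s\<^sup>2 = v\<^sup>2" using has_value_unique[OF V T2] by blast
  then consider "s = v" | "s = - v" by (auto simp: power2_eq_iff)
  then obtain S where S: "S\<^sup>2 = T\<^sup>2" "has_value V S s"
  proof cases
    case 1
    with v that[of T] show ?thesis by simp
  next
    case 2
    have "has_value V (0 - T) (0 - v)"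
      using has_value_const[OF V, of 0] by (intro has_value_diff[OF V] v) simp
    with 2 that[of "- T"] show ?thesis by simp
  qed
  have "S \<noteq> 0" using S(2) s(2) has_value_0_unique[OF V] by blast
  with S T has_values_conchoid_point[OF V R S(2) s(2)] that show ?thesis by simp
qed

theorem proposition2p11:
  fixes V :: "'a::{alg_closed_field, field_char_0} \<Rightarrow> 'a fun_field_ac set"
    and C :: "('a ^ 2) set" and A :: "'a ^ 2" and d :: 'a
  assumes "\<And>t0. place_at t0 (V t0)"
    and "irreducible_plane_curve C"
    and "parametrizable_by_radicals V C"
    and "d \<noteq> 0"
  shows "parametrizable_by_radicals V (conchoid C A d)"
proof -
  note V = assms(1)
  obtain f where f: "Factorial_Ring.irreducible f" "C = {P. eval2 f P = 0}"
    using assms(2) unfolding irreducible_plane_curve_def by blast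
  define covered where
    "covered F = {P. \<exists>t0. \<exists>R\<in>F. defined_at (V t0) R \<and> P = eval_at (V t0) R}"
    for F :: "('a fun_field_ac ^ 2) set"
  obtain Rs where Rs: "finite Rs" "\<And>R. R \<in> Rs \<Longrightarrow> square_parametrization R"
      "\<And>R t0. R \<in> Rs \<Longrightarrow> defined_at (V t0) R \<Longrightarrow> eval_at (V t0) R \<in> C"
      and fin: "finite (C - covered Rs)"
    using assms(3) unfolding parametrizable_by_radicals_def covered_def set_diff_eq by auto
  \<comment> \<open>The conchoid construction is applied to the parametrizations themselves, over the algebraic
      closure of the function field. Constant results are not square parametrizations; each of
      them accounts for only one point of the conchoid.\<close>
  define all where "all = conchoid_points Rs (const_vec A) (const_ac d)"
  define Rs' where "Rs' = all - range const_vec"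
  have fin_all: "finite all" unfolding all_def by (rule finite_conchoid_points[OF Rs(1)])
  have Rs'E: "\<exists>R\<in>Rs. \<exists>S. S\<^sup>2 = norm2_sq (const_vec A - R) \<and> S \<noteq> 0 \<and>
      R' = R + (const_ac d / S) *s (const_vec A - R)" if "R' \<in> Rs'" for R'
    using that unfolding Rs'_def all_def conchoid_points_def by blast
  have "square_parametrization R'" if R': "R' \<in> Rs'" for R'
  proof -
    obtain R S where "R \<in> Rs" "S\<^sup>2 = norm2_sq (const_vec A - R)" "S \<noteq> 0"
      "R' = R + (const_ac d / S) *s (const_vec A - R)" using Rs'E[OF R'] by blast
    then show ?thesis
      using R' square_parametrization_conchoid_point[OF Rs(2)] by (simp add: Rs'_def)
  qed
  moreover have "eval_at (V t0) R' \<in> conchoid C A d"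
    if R': "R' \<in> Rs'" and "defined_at (V t0) R'" for R' t0
  proof -
    obtain R S where "R \<in> Rs" "S\<^sup>2 = norm2_sq (const_vec A - R)" "S \<noteq> 0"
      "R' = R + (const_ac d / S) *s (const_vec A - R)" using Rs'E[OF R'] by blast
    with eval_at_conchoid_point_in_conchoid[OF V Rs(3)] that(2) show ?thesis by blast
  qed
  moreover have "finite (conchoid C A d - covered Rs')"
  proof (rule finite_subset)
    \<comment> \<open>A swept point comes from one of the finitely many points of \<open>C\<close> that \<open>Rs\<close> misses, or is the
        value of a constant result, or is covered.\<close>
    have "Q \<in> conchoid_points (C - covered Rs) A d \<union> const_vec -` all \<union> covered Rs'"
      if "Q \<in> conchoid_points C A d" for Q
    proof -
      obtain P s where P: "Q = P + (d / s) *s (A - P)" "P \<in> C"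
          "s\<^sup>2 = norm2_sq (A - P)" "s \<noteq> 0"
        using \<open>Q \<in> _\<close> unfolding conchoid_points_def by blast
      show ?thesis
      proof (cases "P \<in> covered Rs")
        case False
        with P show ?thesis by (simp add: conchoid_pointsI)
      next
        case True
        then obtain t0 R where R: "R \<in> Rs" "defined_at (V t0) R" "P = eval_at (V t0) R"
          unfolding covered_def by blast
        have "has_values (V t0) R P"
          unfolding R(3) by (rule has_values_eval_at[OF V R(2)])
        then obtain S where S: "S\<^sup>2 = norm2_sq (const_vec A - R)" "S \<noteq> 0"
          and val: "has_values (V t0) (R + (const_ac d / S) *s (const_vec A - R)) Q"
          using conchoid_point_is_value[OF V _ P(3,4)] unfolding P(1) by blast
        define R' where "R' = R + (const_ac d / S) *s (const_vec A - R)"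
        have all: "R' \<in> all"
          unfolding R'_def all_def using R(1) S by (rule conchoid_pointsI)
        have R'Q: "eval_at (V t0) R' = Q" "defined_at (V t0) R'"
          unfolding R'_def
          by (rule has_values_imp_eval_at[OF V val], rule has_values_defined_at[OF V val])
        show ?thesis
        proof (cases "R' \<in> range const_vec")
          case True
          then obtain Q' where Q': "R' = const_vec Q'" by blast
          have "has_values (V t0) R' Q'"
            unfolding Q' has_values_def by (simp add: has_value_const[OF V])
          then have "Q' = Q" using R'Q(1) has_values_imp_eval_at[OF V] by blast
          with all Q' show ?thesis by simp
        next
          case False
          then show ?thesis using all R'Q unfolding Rs'_def covered_def by blast
        qed
      qed
    qed
    then show "conchoid C A d - covered Rs' \<subseteq> (conchoid C A d - conchoid_points C A d) \<union>
        conchoid_points (C - covered Rs) A d \<union> const_vec -` all"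
      by blast
    have "f \<noteq> 0" using f(1) by auto
    then show "finite ((conchoid C A d - conchoid_points C A d) \<union>
        conchoid_points (C - covered Rs) A d \<union> const_vec -` all)"
      using finite_conchoid_minus_points[OF f(2) _ assms(4)] finite_conchoid_points[OF fin]
        finite_vimageI[OF fin_all inj_const_vec] by simp
  qed
  moreover have "finite Rs'" unfolding Rs'_def using fin_all by simp
  ultimately show ?thesis
    unfolding parametrizable_by_radicals_def covered_def set_diff_eq mem_Collect_eq by blast
qed

end
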